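(* Let $\mathfrak{L}$ be the generalized super $W$-algebra described in the context and let $\mathfrak{V}=\mathfrak{L}\otimes\mathfrak{L}$ with the adjoint diagonal action. Then $H^1(\mathfrak{L},\mathfrak{V})=0$. Equivalently, $\mathrm{Der}(\mathfrak{L},\mathfrak{V})=\mathrm{Inn}(\mathfrak{L},\mathfrak{V})$: every derivation from $\mathfrak{L}$ to $\mathfrak{V}$ is inner. This holds in both cases $s\in\Gamma$ and $s\notin\Gamma$ (with $2s\in\Gamma$).
   Context: Let $\Gamma$ be a nontrivial additive subgroup of $\mathbb{R}$, and let $s\in\mathbb{R}$ with $2s\in\Gamma$. The Lie superalgebra $\mathfrak{L}$ over $\mathbb{C}$ has basis $\{L_p,I_p,G_r,H_r\mid p\in\Gamma,\ r\in s+\Gamma\}$. Here $L_p,I_p$ are even and $G_r,H_r$ are odd. The nonzero super-brackets are $[L_p,L_q]=(p-q)L_{p+q}$, $[L_p,I_q]=(p-q)I_{p+q}$, $[L_p,G_r]=(\tfrac p2-r)G_{p+r}$, $[L_p,H_r]=(\tfrac p2-r)H_{p+r}$, $[G_r,G_t]=I_{r+t}$, $[I_p,G_r]=(p-2r)H_{p+r}$. All other brackets of basis elements vanish, apart from those forced by super-antisymmetry. For a homogeneous element $x$, $[x]\in\mathbb{Z}_2$ denotes its parity. Let $\mathfrak{V}=\mathfrak{L}\otimes\mathfrak{L}$ be the algebraic tensor product, with parity $[a\otimes b]=[a]+[b]$. $\mathfrak{L}$ acts on $\mathfrak{V}$ by the adjoint diagonal action $x\circ(a\otimes b)=[x,a]\otimes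 b+(-1)^{[x][a]}a\otimes[x,b]$. A linear map $d:\mathfrak{L}\to\mathfrak{V}$ is a homogeneous derivation of parity $[d]\in\mathbb{Z}_2$ if it shifts parity by $[d]$ and satisfies $d([x,y])=(-1)^{[d][x]}x\circ d(y)-(-1)^{[y]([d]+[x])}y\circ d(x)$ for all homogeneous $x,y$. $\mathrm{Der}(\mathfrak{L},\mathfrak{V})$ is the direct sum of the even and odd derivations. For homogeneous $a\in\mathfrak{V}$, the inner derivation $a_{\mathrm{Inn}}$ is $a_{\mathrm{Inn}}(x)=(-1)^{[a][x]}x\circ a$; this is extended linearly in $a$. $\mathrm{Inn}(\mathfrak{L},\mathfrak{V})$ is the space of all such maps, and $H^1(\mathfrak{L},\mathfrak{V})=\mathrm{Der}(\mathfrak{L},\mathfrak{V})/\mathrm{Inn}(\mathfrak{L},\mathfrak{V})$. *)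

theory Defs
  imports Complex_Main
begin

text \<open>Basis of the generalized super W-algebra: L_p, I_p (even), G_r, H_r (odd).
  Elements of the algebra are finitely supported coefficient functions on the basis;
  elements of the tensor square are finitely supported functions on pairs of basis elements.\<close>

datatype B = L real | I real | G real | H real

fun par :: "B \<Rightarrow> bool" where
  "par (L _) = False" | "par (I _) = False" | "par (G _) = True" | "par (H _) = True"

fun valid :: "real set \<Rightarrow> real \<Rightarrow> B \<Rightarrow> bool" where
  "valid \<Gamma> s (L p) = (p \<in> \<Gamma>)"
| "valid \<Gamma> s (I p) = (p \<in> \<Gamma>)"
| "valid \<Gamma> s (G r) = (r - s \<in> \<Gamma>)"
| "valid \<Gamma> s (H r) = (r - s \<in> \<Gamma>)"

definition vec :: "B \<Rightarrow> complex \<Rightarrow> B \<Rightarrow> complex" where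
  "vec b c = (\<lambda>x. if x = b then c else 0)"

text \<open>Bracket of basis elements, including the ones forced by super-antisymmetry.\<close>
fun br :: "B \<Rightarrow> B \<Rightarrow> B \<Rightarrow> complex" where
  "br (L p) (L q) = vec (L (p + q)) (of_real (p - q))"
| "br (L p) (I q) = vec (I (p + q)) (of_real (p - q))"
| "br (I q) (L p) = vec (I (p + q)) (- of_real (p - q))"
| "br (L p) (G r) = vec (G (p + r)) (of_real (p / 2 - r))"
| "br (G r) (L p) = vec (G (p + r)) (- of_real (p / 2 - r))"
| "br (L p) (H r) = vec (H (p + r)) (of_real (p / 2 - r))"
| "br (H r) (L p) = vec (H (p + r)) (- of_real (p / 2 - r))"
| "br (G r) (G t) = vec (I (r + t)) 1"
| "br (I p) (G r) = vec (H (p + r)) (of_real (p - 2 * r))"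
| "br (G r) (I p) = vec (H (p + r)) (- of_real (p - 2 * r))"
| "br _ _ = (\<lambda>_. 0)"

definition supp :: "('a \<Rightarrow> complex) \<Rightarrow> 'a set" where
  "supp f = {b. f b \<noteq> 0}"

definition Lcar :: "real set \<Rightarrow> real \<Rightarrow> (B \<Rightarrow> complex) set" where
  "Lcar \<Gamma> s = {x. finite (supp x) \<and> (\<forall>b\<in>supp x. valid \<Gamma> s b)}"

definition Vcar :: "real set \<Rightarrow> real \<Rightarrow> (B \<times> B \<Rightarrow> complex) set" where
  "Vcar \<Gamma> s = {v. finite (supp v) \<and> (\<forall>t\<in>supp v. valid \<Gamma> s (fst t) \<and> valid \<Gamma> s (snd t))}"

definition brk :: "(B \<Rightarrow> complex) \<Rightarrow> (B \<Rightarrow> complex) \<Rightarrow> B \<Rightarrow> complex" where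
  "brk x y = (\<lambda>b. \<Sum>c\<in>supp x. \<Sum>d\<in>supp y. x c * y d * br c d b)"

definition tens :: "(B \<Rightarrow> complex) \<Rightarrow> (B \<Rightarrow> complex) \<Rightarrow> B \<times> B \<Rightarrow> complex" where
  "tens u w = (\<lambda>t. u (fst t) * w (snd t))"

definition sg :: "bool \<Rightarrow> complex" where
  "sg q = (if q then -1 else 1)"

definition actb :: "B \<Rightarrow> B \<times> B \<Rightarrow> B \<times> B \<Rightarrow> complex" where
  "actb e t = (\<lambda>k. tens (br e (fst t)) (vec (snd t) 1) k
                 + sg (par e \<and> par (fst t)) * tens (vec (fst t) 1) (br e (snd t)) k)"

definition act :: "(B \<Rightarrow> complex) \<Rightarrow> (B \<times> B \<Rightarrow> complex) \<Rightarrow> B \<times> B \<Rightarrow> complex" where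
  "act x v = (\<lambda>k. \<Sum>e\<in>supp x. \<Sum>t\<in>supp v. x e * v t * actb e t k)"

definition homL :: "real set \<Rightarrow> real \<Rightarrow> bool \<Rightarrow> (B \<Rightarrow> complex) \<Rightarrow> bool" where
  "homL \<Gamma> s q x \<longleftrightarrow> x \<in> Lcar \<Gamma> s \<and> (\<forall>b\<in>supp x. par b = q)"

definition homV :: "real set \<Rightarrow> real \<Rightarrow> bool \<Rightarrow> (B \<times> B \<Rightarrow> complex) \<Rightarrow> bool" where
  "homV \<Gamma> s q v \<longleftrightarrow> v \<in> Vcar \<Gamma> s \<and> (\<forall>t\<in>supp v. (par (fst t) \<noteq> par (snd t)) = q)"

definition evp :: "(B \<Rightarrow> complex) \<Rightarrow> B \<Rightarrow> complex" where
  "evp x = (\<lambda>b. if par b then 0 else x b)"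

definition odp :: "(B \<Rightarrow> complex) \<Rightarrow> B \<Rightarrow> complex" where
  "odp x = (\<lambda>b. if par b then x b else 0)"

definition is_der :: "real set \<Rightarrow> real \<Rightarrow> bool \<Rightarrow> ((B \<Rightarrow> complex) \<Rightarrow> (B \<times> B \<Rightarrow> complex)) \<Rightarrow> bool" where
  "is_der \<Gamma> s p d \<longleftrightarrow>
     (\<forall>x\<in>Lcar \<Gamma> s. d x \<in> Vcar \<Gamma> s)
   \<and> (\<forall>x\<in>Lcar \<Gamma> s. \<forall>y\<in>Lcar \<Gamma> s. d (\<lambda>b. x b + y b) = (\<lambda>k. d x k + d y k))
   \<and> (\<forall>c. \<forall>x\<in>Lcar \<Gamma> s. d (\<lambda>b. c * x b) = (\<lambda>k. c * d x k))
   \<and> (\<forall>q x. homL \<Gamma> s q x \<longrightarrow> homV \<Gamma> s (q \<noteq> p) (d x))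
   \<and> (\<forall>qx qy x y. homL \<Gamma> s qx x \<longrightarrow> homL \<Gamma> s qy y \<longrightarrow>
        d (brk x y) = (\<lambda>k. sg (p \<and> qx) * act x (d y) k
                           - sg (qy \<and> (p \<noteq> qx)) * act y (d x) k))"

definition Der :: "real set \<Rightarrow> real \<Rightarrow> ((B \<Rightarrow> complex) \<Rightarrow> (B \<times> B \<Rightarrow> complex)) \<Rightarrow> bool" where
  "Der \<Gamma> s d \<longleftrightarrow> (\<exists>d0 d1. is_der \<Gamma> s False d0 \<and> is_der \<Gamma> s True d1
       \<and> (\<forall>x\<in>Lcar \<Gamma> s. d x = (\<lambda>k. d0 x k + d1 x k)))"

text \<open>Inner derivation a_Inn for homogeneous a of parity pa:
  a_Inn(x) = (-1)^([a][x]) x \<circ> a, extended linearly in x.\<close>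
definition inn :: "bool \<Rightarrow> (B \<times> B \<Rightarrow> complex) \<Rightarrow> (B \<Rightarrow> complex) \<Rightarrow> B \<times> B \<Rightarrow> complex" where
  "inn pa a x = (\<lambda>k. act (evp x) a k + sg pa * act (odp x) a k)"

text \<open>Inn = span of inner derivations = sums a0_Inn + a1_Inn with a0 even, a1 odd.\<close>
definition Inn :: "real set \<Rightarrow> real \<Rightarrow> ((B \<Rightarrow> complex) \<Rightarrow> (B \<times> B \<Rightarrow> complex)) \<Rightarrow> bool" where
  "Inn \<Gamma> s d \<longleftrightarrow> (\<exists>a0 a1. homV \<Gamma> s False a0 \<and> homV \<Gamma> s True a1
       \<and> (\<forall>x\<in>Lcar \<Gamma> s. d x = (\<lambda>k. inn False a0 x k + inn True a1 x k)))"

end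

theory Submission
  imports Defs
begin

text \<open>
  Write \<open>D e = d e\<close> for basis elements \<open>e\<close>. After subtracting an inner derivation one has
  \<open>D (L 0) = 0\<close>, because the weight-zero part of \<open>D (L 0)\<close> is annihilated by all \<open>L p\<close> and a finitely
  supported tensor with this property vanishes. Then \<open>D (L p)\<close> has weight \<open>p\<close>, and on every
  component \<open>X \<otimes> Y\<close> the derivation becomes a scalar cocycle \<open>\<phi> p i\<close>, where \<open>p\<close> runs through the
  multiples of one positive element of \<open>\<Gamma>\<close>.

  To write \<open>\<phi>\<close> as a coboundary one may first allow infinite support. For a step \<open>f\<close> and \<open>i\<close> with
  \<open>2 i\<close> not a multiple of \<open>f\<close> no coefficient of the recursion \<open>\<phi> f = cobd u f\<close> degenerates; the
  solution \<open>u\<close> which is bounded below also solves the equations for \<open>-f\<close>, \<open>2 f\<close> and \<open>-2 f\<close>, since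
  the errors lie in kernels that contain no function bounded below, and hence for all multiples of
  \<open>f\<close>. The solutions for different \<open>f\<close> agree and determine \<open>u\<close> away from \<open>0\<close>; the cocycle identity
  then leaves only a multiple of the coboundary of the point mass at \<open>0\<close>. That \<open>u\<close> has finite support
  follows by comparing two steps of length 1 with one step of length 2.

  Once \<open>D\<close> vanishes on \<open>L (n g)\<close> for all integers \<open>n\<close>, it commutes with these elements, and acting on
  \<open>D e\<close> by \<open>L (2 p)\<close> after \<open>L p\<close> or by \<open>L (3 p)\<close> produces, for large \<open>p\<close>, tensors of different
  support, so \<open>D e = 0\<close>.
\<close>

section \<open>Cocycles of the Witt algebra in a product of two modules of densities\<close>

section \<open>Scalar cocycles\<close>

text \<open>For basis vectors with \<open>[L p, X x] = (a p - x) X (p + x)\<close> and \<open>[L p, Y y] = (b p - y) Y (p + y)\<close>,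
  \<open>cobd a b u p i\<close> is the coefficient of \<open>X (p - i) \<otimes> Y i\<close> in the action of \<open>L p\<close> on the sum of
  \<open>u j X (- j) \<otimes> Y j\<close> over all \<open>j\<close>.\<close>
definition cobd :: "real \<Rightarrow> real \<Rightarrow> (real \<Rightarrow> complex) \<Rightarrow> real \<Rightarrow> real \<Rightarrow> complex" where
  "cobd a b u p i = of_real (a * p + i) * u i + of_real ((b + 1) * p - i) * u (i - p)"

text \<open>The derivation rule for \<open>[L p, L q]\<close>, read off at
  \<open>X (p + q - i) \<otimes> Y i\<close>, where \<open>\<phi> p i\<close> stands for the
  coefficient of \<open>X (p - i) \<otimes> Y i\<close> in the image of \<open>L p\<close>. Steps
  are integers in a chosen unit, while positions \<open>i\<close> may be any reals.\<close>

definition cocycle :: "real \<Rightarrow> real \<Rightarrow> (int \<Rightarrow> real \<Rightarrow> complex) \<Rightarrow> bool" where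
  "cocycle a b \<phi> \<longleftrightarrow> (\<forall>p q i. of_int (p - q) * \<phi> (p + q) i =
      of_real (a * of_int p - of_int q + i) * \<phi> q i
    + of_real ((b + 1) * of_int p - i) * \<phi> q (i - of_int p)
    - of_real (a * of_int q - of_int p + i) * \<phi> p i
    - of_real ((b + 1) * of_int q - i) * \<phi> p (i - of_int q))"

lemma cocycle_cobd: "cocycle a b (\<lambda>n. cobd a b u (of_int n))"
  unfolding cocycle_def
proof (intro allI)
  fix p q :: int and i :: real
  have e: "i - of_int p - of_int q = i - (of_int p + of_int q)"
          "i - of_int q - of_int p = i - (of_int p + of_int q)" by auto
  show "of_int (p - q) * cobd a b u (of_int (p + q)) i =
      of_real (a * of_int p - of_int q + i) * cobd a b u (of_int q) i
    + of_real ((b + 1) * of_int p - i) * cobd a b u (of_int q) (i - of_int p)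
    - of_real (a * of_int q - of_int p + i) * cobd a b u (of_int p) i
    - of_real ((b + 1) * of_int q - i) * cobd a b u (of_int p) (i - of_int q)"
    unfolding cobd_def e by (simp add: e) algebra
qed

lemma cocycle_diff:
  assumes "cocycle a b \<phi>" "cocycle a b \<psi>"
  shows "cocycle a b (\<lambda>n i. \<phi> n i - \<psi> n i)"
  using assms unfolding cocycle_def by (simp only: right_diff_distrib) (simp add: algebra_simps)

lemma cobd_add: "cobd a b (\<lambda>i. u i + v i) p i = cobd a b u p i + cobd a b v p i"
  by (simp add: cobd_def distrib_left)

lemma cobd_diff: "cobd a b (\<lambda>i. u i - v i) p i = cobd a b u p i - cobd a b v p i"
  by (simp add: cobd_def right_diff_distrib)

text \<open>Every coefficient of the identity is homogeneous of degree 1 in \<open>p\<close>,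
  \<open>q\<close>, \<open>i\<close> together, so scaling all three by \<open>f\<close> produces a
  common factor that cancels.\<close>

lemma cocycle_rescale:
  assumes "cocycle a b \<phi>" "f \<noteq> 0"
  shows "cocycle a b (\<lambda>n i. \<phi> (n * f) (of_int f * i))"
  unfolding cocycle_def
proof (intro allI)
  fix p q :: int and i :: real
  have f: "of_int f \<noteq> (0::complex)" using assms(2) by simp
  have "of_int (p * f - q * f) * \<phi> (p * f + q * f) (of_int f * i) =
      of_real (a * of_int (p * f) - of_int (q * f) + of_int f * i) * \<phi> (q * f) (of_int f * i)
    + of_real ((b + 1) * of_int (p * f) - of_int f * i) * \<phi> (q * f) (of_int f * i - of_int (p * f))
    - of_real (a * of_int (q * f) - of_int (p * f) + of_int f * i) * \<phi> (p * f) (of_int f * i)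
    - of_real ((b + 1) * of_int (q * f) - of_int f * i) * \<phi> (p * f) (of_int f * i - of_int (q * f))"
    using assms(1) unfolding cocycle_def by blast
  then have "of_int f * (of_int (p - q) * \<phi> ((p + q) * f) (of_int f * i)) =
      of_int f * (of_real (a * of_int p - of_int q + i) * \<phi> (q * f) (of_int f * i)
    + of_real ((b + 1) * of_int p - i) * \<phi> (q * f) (of_int f * (i - of_int p))
    - of_real (a * of_int q - of_int p + i) * \<phi> (p * f) (of_int f * i)
    - of_real ((b + 1) * of_int q - i) * \<phi> (p * f) (of_int f * (i - of_int q)))"
    by (simp add: algebra_simps)
  then show "of_int (p - q) * \<phi> ((p + q) * f) (of_int f * i) =
      of_real (a * of_int p - of_int q + i) * \<phi> (q * f) (of_int f * i)
    + of_real ((b + 1) * of_int p - i) * \<phi> (q * f) (of_int f * (i - of_int p))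
    - of_real (a * of_int q - of_int p + i) * \<phi> (p * f) (of_int f * i)
    - of_real ((b + 1) * of_int q - i) * \<phi> (p * f) (of_int f * (i - of_int q))"
    using f by simp
qed

section \<open>First-order recursions: solutions bounded below and finiteness of support\<close>

text \<open>The solution \<open>u\<close> of \<open>cobd a b u 1 = g\<close> that vanishes below \<open>C\<close>; on \<open>- a + \<nat>\<close> its values are junk (division by 0).\<close>
function upsol :: "real \<Rightarrow> real \<Rightarrow> real \<Rightarrow> (real \<Rightarrow> complex) \<Rightarrow> real \<Rightarrow> complex" where
  "upsol a b C g i = (if i < C then 0
     else (g i - of_real (b + 1 - i) * upsol a b C g (i - 1)) / of_real (a + i))"
  by auto
termination
proof (relation "measure (\<lambda>(a, b, C, g, i). nat \<lceil>i - C + 1\<rceil>)", goal_cases)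
  case (2 a b C g i)
  then have "nat \<lceil>i - 1 - C + 1\<rceil> < nat \<lceil>i - C + 1\<rceil>" by linarith
  then show ?case by (simp only: in_measure prod.case)
qed simp

declare upsol.simps [simp del]

text \<open>The uniqueness principle for recursions: induction on how many steps of length
  \<open>s\<close> lie between \<open>C\<close> and \<open>i\<close>. \<open>N\<close> singles out
  positions where the leading coefficient does not vanish.\<close>

lemma upward_zero:
  fixes \<psi> :: "real \<Rightarrow> complex"
  assumes low: "\<And>i. i < C \<Longrightarrow> \<psi> i = 0" and s: "s > 0"
    and N: "\<And>i. N i \<Longrightarrow> N (i - s)"
    and step: "\<And>i. N i \<Longrightarrow> \<psi> (i - s) = 0 \<Longrightarrow> \<psi> i = 0"
    and "N i"
  shows "\<psi> i = 0"
proof -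
  obtain n :: nat where n: "i < C + of_nat n * s"
    using ex_less_of_nat_mult[OF s, of "i - C"] by (auto simp: algebra_simps)
  have "\<And>i. N i \<Longrightarrow> i < C + of_nat n * s \<Longrightarrow> \<psi> i = 0" for n :: nat
  proof (induction n)
    case 0 then show ?case using low by simp
  next
    case (Suc n)
    have "\<psi> (i - s) = 0" using Suc.IH[of "i - s"] N Suc.prems by (simp add: algebra_simps)
    then show ?case using step Suc.prems by blast
  qed
  then show ?thesis using n \<open>N i\<close> by blast
qed

lemma finite_supp_bound:
  assumes "finite (supp (g :: real \<Rightarrow> complex))"
  obtains C where "\<And>i. i < C \<Longrightarrow> g i = 0"
proof -
  have "i \<ge> Min (insert 0 (supp g))" if "g i \<noteq> 0" for i
    using that assms by (intro Min_le) (auto simp: supp_def)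
  then show ?thesis using that[of "Min (insert 0 (supp g))"] by force
qed

text \<open>The parameter is 1 for the families \<open>L\<close>, \<open>I\<close> and 1/2 for
  \<open>G\<close>, \<open>H\<close>.\<close>

abbreviation half_or_one :: "real \<Rightarrow> bool" where
  "half_or_one a \<equiv> a = 1 / 2 \<or> a = 1"

text \<open>The cubic and quadratic terms cancel; the expression equals
  \<open>(a + b + 1) * ((b - a) * j + 2 * (a + 1) * b)\<close>. For \<open>a = b\<close> this is a
  nonzero constant; otherwise its only root is 4 for \<open>a = 1\<close>, \<open>b = 1/2\<close>
  and -6 for \<open>a = 1/2\<close>, \<open>b = 1\<close>.\<close>

lemma two_step_factors_differ:
  assumes a: "half_or_one a" and b: "half_or_one b"
    and "(2 * a + j + 2) * (j - b) * (j + 1 - b) - (j - 2 * b) * (a + j + 1) * (a + j + 2) = 0"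
  shows "j = 4 \<or> j = -6"
proof -
  define A B where "A = 2 * a" and "B = 2 * b"
  have "A = 1 \<or> A = 2" "B = 1 \<or> B = 2" using a b unfolding A_def B_def by auto
  moreover have "(A + j + 2) * (2 * j - B) * (2 * j + 2 - B) - (j - B) * (A + 2 * j + 2) * (A + 2 * j + 4) = 0"
    using assms(3) unfolding A_def B_def by algebra
  ultimately show ?thesis by (auto simp: algebra_simps)
qed

text \<open>Going from \<open>i - 2\<close> to \<open>i\<close> by two steps of length 1 or by one step of length 2 gives
  different factors, except for at most one value of \<open>i\<close>.\<close>
lemma finite_supp_if_cobd_finite_supp:
  assumes a: "half_or_one a" and b: "half_or_one b"
    and f1: "finite (supp g1)" and f2: "finite (supp g2)"
    and N: "\<And>j. N j \<Longrightarrow> N (j + 1)"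
    and g1: "\<And>i. N i \<Longrightarrow> g1 i = cobd a b u 1 i"
    and g2: "\<And>i. N i \<Longrightarrow> g2 i = cobd a b u 2 i"
  shows "finite {j. N j \<and> u j \<noteq> 0}"
proof -
  have "j \<in> {4, -6} \<union> (\<lambda>i. i - 1) ` supp g1 \<union> (\<lambda>i. i - 2) ` supp g1 \<union> (\<lambda>i. i - 2) ` supp g2"
    if j: "N j" "u j \<noteq> 0" for j
  proof (rule ccontr)
    assume n: "\<not> ?thesis"
    then have "j + 1 \<notin> supp g1" "j + 2 \<notin> supp g1" "j + 2 \<notin> supp g2" by force+
    moreover have "N (j + 1)" "N (j + 2)" using N[of j] N[of "j + 1"] j by (auto simp: add.assoc)
    ultimately have z: "cobd a b u 1 (j + 1) = 0" "cobd a b u 1 (j + 2) = 0" "cobd a b u 2 (j + 2) = 0"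
      using g1 g2 unfolding supp_def by auto
    have e: "of_real (a + j + 1) * u (j + 1) = of_real (j - b) * u j"
      "of_real (a + j + 2) * u (j + 2) = of_real (j + 1 - b) * u (j + 1)"
      "of_real (2 * a + j + 2) * u (j + 2) = of_real (j - 2 * b) * u j"
      using z unfolding cobd_def by (simp_all add: algebra_simps)
    \<comment> \<open>The values \<open>u (j + 1)\<close> and \<open>u (j + 2)\<close> are
      eliminated by cross-multiplication, because any of the leading factors may be zero.\<close>
    have "of_real ((2 * a + j + 2) * (j - b) * (j + 1 - b) - (j - 2 * b) * (a + j + 1) * (a + j + 2)) * u j = 0"
    proof -
      have "of_real (a + j + 1) * of_real (a + j + 2) * (of_real (2 * a + j + 2) * u (j + 2))
        = of_real (2 * a + j + 2) * of_real (a + j + 1) * (of_real (a + j + 2) * u (j + 2))" by (simp only: mult_ac)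
      also have "\<dots> = of_real (2 * a + j + 2) * of_real (j + 1 - b) * (of_real (a + j + 1) * u (j + 1))"
        unfolding e(2) by (simp only: mult_ac)
      finally have "of_real ((2 * a + j + 2) * (j - b) * (j + 1 - b)) * u j
          = of_real ((j - 2 * b) * (a + j + 1) * (a + j + 2)) * u j"
        unfolding e(3) e(1) of_real_mult by (simp only: mult_ac)
      then show ?thesis by (subst of_real_diff, subst left_diff_distrib, simp only: right_minus_eq)
    qed
    then have "(2 * a + j + 2) * (j - b) * (j + 1 - b) - (j - 2 * b) * (a + j + 1) * (a + j + 2) = 0"
      using j(2) by (metis mult_eq_0_iff of_real_eq_0_iff)
    moreover have "j \<noteq> 4" "j \<noteq> -6" using n by auto
    ultimately show False using two_step_factors_differ[OF a b] by blast
  qed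
  then have "{j. N j \<and> u j \<noteq> 0} \<subseteq>
    {4, -6} \<union> (\<lambda>i. i - 1) ` supp g1 \<union> (\<lambda>i. i - 2) ` supp g1 \<union> (\<lambda>i. i - 2) ` supp g2" by blast
  then show ?thesis by (rule finite_subset) (use f1 f2 in simp)
qed

section \<open>Cocycles at positions where no recursion degenerates\<close>

definition generic :: "int \<Rightarrow> real \<Rightarrow> bool" where
  "generic f i \<longleftrightarrow> (\<forall>k::int. 2 * i \<noteq> of_int (k * f))"

lemma generic_shift: "generic f (i + of_int (k * f)) \<longleftrightarrow> generic f i"
proof -
  have "generic f j \<Longrightarrow> generic f (j + of_int (k * f))" for j k
    unfolding generic_def
  proof (intro allI notI)
    fix l :: int assume g: "\<forall>k::int. 2 * j \<noteq> of_int (k * f)" and "2 * (j + of_int (k * f)) = of_int (l * f)"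
    then have "2 * j = of_int ((l - 2 * k) * f)" by (simp add: algebra_simps)
    then show False using g by blast
  qed
  from this[of i k] this[of "i + of_int (k * f)" "- k"] show ?thesis by auto
qed

text \<open>This is why \<open>generic\<close> speaks of \<open>2 * i\<close>: with \<open>a\<close>
  equal to 1/2 or 1, a zero of the coefficient makes \<open>2 * i\<close> an integer multiple of
  \<open>f\<close>.\<close>

lemma generic_nonzero:
  assumes "generic f i" "half_or_one a"
  shows "of_real (a * of_int (k * f) + i) \<noteq> (0::complex)"
proof
  assume "of_real (a * of_int (k * f) + i) = (0::complex)"
  then have "a * of_int (k * f) + i = 0" using of_real_eq_0_iff by blast
  then have "i = - a * of_int (k * f)" by simp
  then have "2 * i = of_int (- k * f) \<or> 2 * i = of_int (- 2 * k * f)" using assms(2) by (elim disjE) simp_all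
  then show False using assms unfolding generic_def by blast
qed

text \<open>The error \<psi> of the upward solution for step 1 is again a cocycle, and each \<psi> n
  is bounded below. The pairs \<open>(1, -1)\<close>, \<open>(-1, 2)\<close> and
  \<open>(1, -2)\<close> give homogeneous recursions for \<psi> at -1, 2 and -2, so these vanish.
  The remaining n follow by induction; it starts at 2 and -2 because the factor \<open>p - q\<close>
  is zero for \<open>(1, 1)\<close> and \<open>(-1, -1)\<close>.\<close>

lemma cocycle_generic:
  assumes ab: "half_or_one a" "half_or_one b" and co: "cocycle a b \<phi>"
    and fin: "\<And>n. finite (supp (\<phi> n))" and zero: "\<And>i. \<phi> 0 i = 0"
  shows "\<exists>u. finite (supp u) \<and> (\<forall>n i. generic 1 i \<longrightarrow> \<phi> n i = cobd a b u (of_int n) i)"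
proof -
  obtain C where C: "\<And>i. i < C \<Longrightarrow> \<phi> 1 i = 0" by (rule finite_supp_bound[OF fin]) blast
  define u where "u = upsol a b C (\<phi> 1)"
  have u0: "u i = 0" if "i < C" for i using that unfolding u_def by (subst upsol.simps) simp
  define \<psi> where "\<psi> n i = \<phi> n i - cobd a b u (of_int n) i" for n :: int and i
  have nz: "of_real (a * of_int k + i) \<noteq> (0::complex)" "of_real (b * of_int k + i) \<noteq> (0::complex)"
    if "generic 1 i" for i k using generic_nonzero[of 1 i _ k] that ab by auto
  have g: "generic 1 (i - 1)" "generic 1 (i + 1)" if "generic 1 i" for i
    using generic_shift[of 1 i "-1"] generic_shift[of 1 i 1] that by auto
  have gn: "generic 1 (i - of_int k)" if "generic 1 i" for i k
    using generic_shift[of 1 i "-k"] that by auto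
  have co: "of_int (p - q) * \<psi> (p + q) i =
      of_real (a * of_int p - of_int q + i) * \<psi> q i
    + of_real ((b + 1) * of_int p - i) * \<psi> q (i - of_int p)
    - of_real (a * of_int q - of_int p + i) * \<psi> p i
    - of_real ((b + 1) * of_int q - i) * \<psi> p (i - of_int q)" for p q i
    using cocycle_diff[OF co cocycle_cobd] unfolding \<psi>_def cocycle_def by blast
  have low: "\<exists>C. \<forall>i<C. \<psi> n i = 0" for n
  proof -
    obtain C' where C': "\<And>i. i < C' \<Longrightarrow> \<phi> n i = 0" by (rule finite_supp_bound[OF fin]) blast
    \<comment> \<open>Below the three bounds, \<open>\<phi> n i\<close>, \<open>u i\<close> and
      \<open>u (i - n)\<close> vanish respectively.\<close>
    have "\<forall>i<min C' (min C (C + of_int n)). \<psi> n i = 0"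
      using C' u0 unfolding \<psi>_def cobd_def by auto
    then show ?thesis by blast
  qed
  have up: "\<psi> n i = 0" if "\<And>i. generic 1 i \<Longrightarrow> \<psi> n (i - 1) = 0 \<Longrightarrow> \<psi> n i = 0" "generic 1 i" for n i
    using low[of n] upward_zero[where N = "generic 1" and s = 1] that g by auto
  have p1: "\<psi> 1 i = 0" if "generic 1 i" for i
  proof (cases "i < C")
    case True
    then show ?thesis unfolding \<psi>_def cobd_def using C u0 by auto
  next
    case False
    have "of_real (a + i) \<noteq> (0::complex)" using nz(1)[OF that, of 1] by simp
    moreover have "u i = (\<phi> 1 i - of_real (b + 1 - i) * u (i - 1)) / of_real (a + i)"
      using False unfolding u_def by (subst upsol.simps) simp
    ultimately have "of_real (a + i) * u i = \<phi> 1 i - of_real (b + 1 - i) * u (i - 1)" by simp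
    then show ?thesis unfolding \<psi>_def cobd_def by simp
  qed
  have p0: "\<psi> 0 i = 0" for i using zero unfolding \<psi>_def cobd_def by simp
  have pm1: "\<psi> (-1) i = 0" if "generic 1 i" for i
  proof (rule up[OF _ that])
    fix i assume i: "generic 1 i" "\<psi> (-1) (i - 1) = 0"
    have "of_real (a + 1 + i) * \<psi> (-1) i = 0"
      using co[of 1 "-1" i] p1[OF i(1)] p1[OF g(2)[OF i(1)]] i(2) p0 by simp
    moreover have "of_real (a + 1 + i) \<noteq> (0::complex)"
      using nz(1)[OF g(2)[OF i(1)], of 1] by (simp add: add_ac)
    ultimately show "\<psi> (-1) i = 0" by (metis mult_eq_0_iff)
  qed
  have p2: "\<psi> 2 i = 0" if "generic 1 i" for i
  proof (rule up[OF _ that])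
    fix i assume i: "generic 1 i" "\<psi> 2 (i - 1) = 0"
    have g': "generic 1 (i - 3)" using gn[OF i(1), of 3] by simp
    \<comment> \<open>With \<open>p = -1\<close> the shifted position is
      \<open>i - 1 - p = i\<close>, so evaluating at \<open>i - 1\<close> relates
      \<open>\<psi> 2 i\<close> to \<open>\<psi> 2 (i - 1)\<close>.\<close>
    have "of_real (b + i) * \<psi> 2 i = 0"
      using co[of "-1" 2 "i - 1"] p1[OF g(1)[OF i(1)]] pm1[OF g(1)[OF i(1)]] pm1[OF g'] i(2)
      by (simp add: algebra_simps)
    moreover have "of_real (b + i) \<noteq> (0::complex)"
      using nz(2)[OF i(1), of 1] by simp
    ultimately show "\<psi> 2 i = 0" by (metis mult_eq_0_iff)
  qed
  have pm2: "\<psi> (-2) i = 0" if "generic 1 i" for i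
  proof (rule up[OF _ that])
    fix i assume i: "generic 1 i" "\<psi> (-2) (i - 1) = 0"
    have g': "generic 1 (i + 2)" using gn[OF i(1), of "-2"] by simp
    have "of_real (a + 2 + i) * \<psi> (-2) i = 0"
      using co[of 1 "-2" i] p1[OF i(1)] p1[OF g'] pm1[OF i(1)] i(2) by simp
    moreover have "of_real (a + 2 + i) \<noteq> (0::complex)"
      using nz(1)[OF g', of 1] by (simp add: add_ac)
    ultimately show "\<psi> (-2) i = 0" by (metis mult_eq_0_iff)
  qed
  have pos: "\<forall>i. generic 1 i \<longrightarrow> \<psi> n i = 0" if "n \<ge> 2" for n
    using that
  proof (induction n rule: int_ge_induct)
    case base then show ?case using p2 by blast
  next
    case (step n)
    show ?case
    proof (intro allI impI)
      fix i assume i: "generic 1 i"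
      have "of_int (1 - n) * \<psi> (1 + n) i = 0"
        using co[of 1 n i] p1[OF i] p1[OF gn[OF i, of n]] step.IH i g(1)[OF i] by simp
      then have "of_int (1 - n) = (0::complex) \<or> \<psi> (1 + n) i = 0" by (simp only: mult_eq_0_iff)
      then show "\<psi> (n + 1) i = 0" using step.hyps by (simp only: of_int_eq_0_iff add.commute) auto
    qed
  qed
  have neg: "\<forall>i. generic 1 i \<longrightarrow> \<psi> n i = 0" if "n \<le> -2" for n
    using that
  proof (induction n rule: int_le_induct)
    case base then show ?case using pm2 by blast
  next
    case (step n)
    show ?case
    proof (intro allI impI)
      fix i assume i: "generic 1 i"
      have "of_int (- 1 - n) * \<psi> (- 1 + n) i = 0"
        using co[of "-1" n i] pm1[OF i] pm1[OF gn[OF i, of n]] step.IH i g(2)[OF i] by simp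
      then have "of_int (- 1 - n) = (0::complex) \<or> \<psi> (- 1 + n) i = 0" by (simp only: mult_eq_0_iff)
      then show "\<psi> (n - 1) i = 0" using step.hyps by (simp only: of_int_eq_0_iff) auto
    qed
  qed
  have all: "\<phi> n i = cobd a b u (of_int n) i" if "generic 1 i" for n i
  proof -
    have "n \<ge> 2 \<or> n = 1 \<or> n = 0 \<or> n = -1 \<or> n \<le> -2" by auto
    then have "\<psi> n i = 0" using that pos neg p0 p1 pm1 by blast
    then show ?thesis unfolding \<psi>_def by simp
  qed
  have fu: "finite {j. generic 1 j \<and> u j \<noteq> 0}"
    by (rule finite_supp_if_cobd_finite_supp[OF ab fin[of 1] fin[of 2]]) (use all g in force)+
  \<comment> \<open>Finiteness of support is known at generic positions only. Cutting
    \<open>u\<close> off elsewhere is harmless, since integer shifts preserve genericity and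
    \<open>cobd\<close> never mixes the two kinds of position.\<close>
  let ?u = "\<lambda>i. if generic 1 i then u i else 0"
  have "finite (supp ?u)" by (rule finite_subset[OF _ fu]) (auto simp: supp_def)
  moreover have "\<phi> n i = cobd a b ?u (of_int n) i" if "generic 1 i" for n i
    using all[OF that, of n] that gn[OF that, of n] unfolding cobd_def by simp
  ultimately show ?thesis by blast
qed

text \<open>The degenerate values of \<open>i\<close> for step length \<open>f\<close> satisfy \<open>f dvd 2 * i\<close>; varying \<open>f\<close>
  therefore reaches every \<open>i \<noteq> 0\<close>.\<close>
lemma cocycle_generic_multiple:
  assumes ab: "half_or_one a" "half_or_one b" and co: "cocycle a b \<phi>"
    and fin: "\<And>n. finite (supp (\<phi> n))" and zero: "\<And>i. \<phi> 0 i = 0" and f: "f > 0"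
  shows "\<exists>u. finite (supp u) \<and> (\<forall>n i. generic f i \<longrightarrow> \<phi> (n * f) i = cobd a b u (of_int (n * f)) i)"
proof -
  define \<chi> where "\<chi> n i = \<phi> (n * f) (of_int f * i)" for n i
  have f': "of_int f \<noteq> (0::real)" "of_int f \<noteq> (0::complex)" using f by auto
  have "finite (supp (\<chi> n))" for n
  proof (rule finite_subset)
    show "supp (\<chi> n) \<subseteq> (\<lambda>i. i / of_int f) ` supp (\<phi> (n * f))"
    proof
      fix i assume "i \<in> supp (\<chi> n)"
      then have "of_int f * i \<in> supp (\<phi> (n * f))" unfolding supp_def \<chi>_def by simp
      moreover have "i = (of_int f * i) / of_int f" using f' by simp
      ultimately show "i \<in> (\<lambda>i. i / of_int f) ` supp (\<phi> (n * f))" by blast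
    qed
  qed (use fin in simp)
  moreover have "cocycle a b \<chi>" unfolding \<chi>_def using cocycle_rescale[OF co] f by auto
  moreover have "\<chi> 0 i = 0" for i unfolding \<chi>_def using zero by simp
  ultimately obtain u where u: "finite (supp u)"
    "\<And>n i. generic 1 i \<Longrightarrow> \<chi> n i = cobd a b u (of_int n) i"
    using cocycle_generic[OF ab, of \<chi>] by blast
  \<comment> \<open>The division by \<open>f\<close> compensates for the coefficients of
    \<open>cobd\<close>, which grow by the factor \<open>f\<close> when step and position are
    scaled.\<close>
  define v where "v i = u (i / of_int f) / of_int f" for i
  have "supp v \<subseteq> (\<lambda>i. i * of_int f) ` supp u"
  proof
    fix i assume "i \<in> supp v"
    then have "i / of_int f \<in> supp u" unfolding supp_def v_def by auto
    moreover have "i = (i / of_int f) * of_int f" using f' by simp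
    ultimately show "i \<in> (\<lambda>i. i * of_int f) ` supp u" by blast
  qed
  then have "finite (supp v)" using u(1) finite_surj by blast
  moreover have "\<phi> (n * f) i = cobd a b v (of_int (n * f)) i" if "generic f i" for n i
  proof -
    have "generic 1 (i / of_int f)"
      using that f' unfolding generic_def by (auto simp: field_simps)
    from u(2)[OF this, of n] have "\<phi> (n * f) i = cobd a b u (of_int n) (i / of_int f)"
      unfolding \<chi>_def using f' by simp
    also have "\<dots> = cobd a b v (of_int (n * f)) i"
    proof -
      have e: "i / of_int f - of_int n = (i - of_int (n * f)) / of_int f" using f' by (simp add: field_simps)
      have c: "a * of_int n + i / of_int f = (a * of_int (n * f) + i) / of_int f"
        "(b + 1) * of_int n - i / of_int f = ((b + 1) * of_int (n * f) - i) / of_int f"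
        using f' by (simp_all add: field_simps)
      show ?thesis unfolding cobd_def v_def e c by (simp only: of_real_divide) simp
    qed
    finally show ?thesis .
  qed
  ultimately show ?thesis by blast
qed

section \<open>Gluing the solutions for different step lengths\<close>

lemma generic_large: "i \<noteq> 0 \<Longrightarrow> \<bar>2 * i\<bar> < of_int f \<Longrightarrow> generic f i"
  unfolding generic_def
proof (intro allI notI)
  fix k assume i: "i \<noteq> 0" "\<bar>2 * i\<bar> < of_int f" and k: "2 * i = of_int (k * f)"
  then have "\<bar>k * f\<bar> < f" by linarith
  then have "\<bar>k\<bar> * \<bar>f\<bar> < 1 * \<bar>f\<bar>" by (simp add: abs_mult)
  then have "k = 0" using mult_less_cancel_right[of "\<bar>k\<bar>" "\<bar>f\<bar>" 1] by auto
  then show False using k i by simp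
qed

theorem cocycle_is_cobd:
  assumes ab: "half_or_one a" "half_or_one b" and co: "cocycle a b \<phi>"
    and fin: "\<And>n. finite (supp (\<phi> n))" and zero: "\<And>i. \<phi> 0 i = 0"
  shows "\<exists>u. finite (supp u) \<and> (\<forall>n i. \<phi> n i = cobd a b u (of_int n) i)"
proof -
  have "\<forall>f. \<exists>u. f > 0 \<longrightarrow> finite (supp u) \<and>
      (\<forall>n i. generic f i \<longrightarrow> \<phi> (n * f) i = cobd a b u (of_int (n * f)) i)"
    using cocycle_generic_multiple[OF ab co fin zero] by blast
  then obtain U where U: "\<And>f. f > 0 \<Longrightarrow> finite (supp (U f))"
    "\<And>f n i. f > 0 \<Longrightarrow> generic f i \<Longrightarrow> \<phi> (n * f) i = cobd a b (U f) (of_int (n * f)) i" by metis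
  \<comment> \<open>Both functions solve the recursion with step \<open>f * g\<close> at positions
    generic for \<open>f\<close>. Their difference has finite support and lies in the kernel, hence
    vanishes there.\<close>
  have compat: "U f i = U (f * g) i" if fg: "f > 0" "g > 0" and i: "generic f i" for f g i
  proof -
    let ?w = "\<lambda>i. U f i - U (f * g) i"
    have "finite (supp ?w)"
      by (rule finite_subset[OF _ finite_UnI[OF U(1)[of f] U(1)[of "f * g"]]]) (use fg in \<open>auto simp: supp_def\<close>)
    then obtain C where "\<And>i. i < C \<Longrightarrow> ?w i = 0" by (rule finite_supp_bound) blast
    then have "?w i = 0"
    proof (rule upward_zero[where N = "generic f" and s = "of_int (f * g)"])
      show "(0::real) < of_int (f * g)" using fg by simp
      show "generic f (i - of_int (f * g))" if "generic f i" for i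
        using generic_shift[of f i "- g"] that by (simp add: mult.commute)
      show "?w i = 0" if i: "generic f i" and 0: "?w (i - of_int (f * g)) = 0" for i
      proof -
        have "generic (f * g) i" using i unfolding generic_def by (simp only: mult.assoc[symmetric] mult.commute[of f]) blast
        then have "cobd a b ?w (of_int (g * f)) i = 0"
          using U(2)[of f i g] U(2)[of "f * g" i 1] fg i unfolding cobd_diff by (simp add: mult.commute)
        then have "of_real (a * of_int (g * f) + i) * ?w i = 0"
          using 0 unfolding cobd_def by (simp add: mult.commute)
        then show ?thesis using generic_nonzero[OF i ab(1), of g] by (simp only: mult_eq_0_iff) blast
      qed
    qed (use i in auto)
    then show ?thesis by simp
  qed
  \<comment> \<open>For \<open>i \<noteq> 0\<close> this step length exceeds
    \<open>\<bar>2 * i\<bar>\<close>, so \<open>i\<close> is generic for it. The value at 0 is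
    arbitrary and is corrected by \<open>c\<close> below.\<close>
  define u where "u i = U (\<lfloor>\<bar>2 * i\<bar>\<rfloor> + 1) i" for i
  have uU: "u i = U f i" if "f > 0" "generic f i" for f i
  proof -
    let ?m = "\<lfloor>\<bar>2 * i\<bar>\<rfloor> + 1"
    have "i \<noteq> 0" using that unfolding generic_def by (metis mult_zero_left mult_zero_right of_int_0)
    then have "generic ?m i" by (rule generic_large) linarith
    moreover have "?m > 0" by (simp add: add_pos_nonneg)
    ultimately have "U ?m i = U (?m * f) i" "U f i = U (f * ?m) i" using compat that by blast+
    then show ?thesis unfolding u_def by (simp add: mult.commute)
  qed
  define \<psi> where "\<psi> n i = \<phi> n i - cobd a b u (of_int n) i" for n :: int and i
  have co: "of_int (p - q) * \<psi> (p + q) i =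
      of_real (a * of_int p - of_int q + i) * \<psi> q i
    + of_real ((b + 1) * of_int p - i) * \<psi> q (i - of_int p)
    - of_real (a * of_int q - of_int p + i) * \<psi> p i
    - of_real ((b + 1) * of_int q - i) * \<psi> p (i - of_int q)" for p q i
    using cocycle_diff[OF co cocycle_cobd] unfolding \<psi>_def cocycle_def by blast
  have gen: "\<psi> n i = 0" if "n \<noteq> 0" "generic \<bar>n\<bar> i" for n i
  proof -
    have n: "n = sgn n * \<bar>n\<bar>" by (simp add: sgn_mult_abs)
    have "generic \<bar>n\<bar> (i - of_int n)" using generic_shift[of "\<bar>n\<bar>" i "- sgn n"] that n by simp
    moreover have "\<phi> n i = cobd a b (U \<bar>n\<bar>) (of_int n) i"
      using U(2)[of "\<bar>n\<bar>" i "sgn n"] that n by simp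
    ultimately show ?thesis using that unfolding \<psi>_def cobd_def by (simp add: uU[of "\<bar>n\<bar>"])
  qed
  have p0: "\<psi> 0 i = 0" for i using zero unfolding \<psi>_def cobd_def by simp
  have far: "\<psi> n i = 0" if i: "i \<noteq> 0" "i \<noteq> of_int n" for n i
  proof (cases "n = 0")
    case False
    \<comment> \<open>Write \<open>n = p + q\<close> with \<open>p < 0 < q\<close> so large that
      \<open>i\<close> and \<open>i - n\<close> are generic for both \<open>\<bar>p\<bar>\<close>
      and \<open>\<bar>q\<bar>\<close>. Since \<open>i - p = (i - n) + q\<close> and
      \<open>i - q = (i - n) + p\<close>, all four terms on the right of the cocycle identity
      vanish, while \<open>p - q\<close> is nonzero.\<close>
    define q where "q = \<lceil>\<bar>2 * i\<bar> + \<bar>2 * (i - of_int n)\<bar>\<rceil> + \<bar>n\<bar> + 1"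
    define p where "p = n - q"
    have q: "\<bar>2 * i\<bar> + \<bar>2 * (i - of_int n)\<bar> + \<bar>of_int n\<bar> < of_int q" "q > \<bar>n\<bar>"
      unfolding q_def by linarith+
    have qp: "q > 0" "p < 0" "\<bar>q\<bar> = q" "\<bar>p\<bar> = q - n" using q unfolding p_def by auto
    have g: "generic \<bar>q\<bar> i" "generic \<bar>q\<bar> (i - of_int n)" "generic \<bar>p\<bar> i" "generic \<bar>p\<bar> (i - of_int n)"
      using i q unfolding qp by (auto intro!: generic_large)
    have "generic \<bar>q\<bar> (i - of_int p)"
      using generic_shift[of "\<bar>q\<bar>" "i - of_int n" 1] g(2) qp unfolding p_def by (simp add: algebra_simps)
    moreover have "generic \<bar>p\<bar> (i - of_int q)"
      using generic_shift[of "\<bar>p\<bar>" "i - of_int n" "-1"] g(4) qp by (simp add: algebra_simps)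
    ultimately have "of_int (p - q) * \<psi> (p + q) i = 0"
      using co[of p q i] gen g qp by simp
    then have "of_int (p - q) = (0::complex) \<or> \<psi> (p + q) i = 0" by (simp only: mult_eq_0_iff)
    then show ?thesis using qp unfolding of_int_eq_0_iff p_def by auto
  qed (use p0 in simp)
  have nz: "of_real a \<noteq> (0::complex)" "of_real b \<noteq> (0::complex)" using ab by auto
  \<comment> \<open>Only \<open>\<psi> n 0\<close> and \<open>\<psi> n n\<close> can survive. At
    \<open>i = p\<close> the cocycle identity relates one to the other, which makes
    \<open>\<psi> q 0 / (a * q)\<close> and \<open>\<psi> p p / (b * p)\<close> a common constant
    \<open>c\<close>: exactly the coboundary of \<open>c\<close> times the point mass at 0.\<close>
  have rel: "of_real b * of_int p * \<psi> q 0 = of_real a * of_int q * \<psi> p (of_int p)"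
    if "p \<noteq> 0" "q \<noteq> 0" "p \<noteq> q" for p q
  proof -
    have "\<psi> (p + q) (of_int p) = 0" "\<psi> q (of_int p) = 0" "\<psi> p (of_int p - of_int q) = 0"
      using that by (auto intro!: far)
    then show ?thesis using co[of p q "of_int p"] by (simp add: algebra_simps)
  qed
  define c where "c = \<psi> 1 0 / of_real a"
  have b1: "\<psi> p (of_int p) = of_real b * of_int p * c" if "p \<noteq> 0" "p \<noteq> 1" for p
    using rel[of p 1] that nz unfolding c_def by (simp add: field_simps)
  have a1: "\<psi> q 0 = of_real a * of_int q * c" if "q \<noteq> 0" for q
  proof -
    obtain p :: int where p: "p \<noteq> 0" "p \<noteq> 1" "p \<noteq> q" using that[of 2] that[of 3] by force
    have "of_real b * of_int p * \<psi> q 0 = of_real a * of_int q * (of_real b * of_int p * c)"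
      using rel[of p q] b1[of p] p that by simp
    then show ?thesis using p nz by simp
  qed
  have b2: "\<psi> p (of_int p) = of_real b * of_int p * c" if "p \<noteq> 0" for p
  proof (cases "p = 1")
    case True
    then show ?thesis using rel[of 1 2] a1[of 2] nz by (simp add: field_simps)
  qed (use b1 that in simp)
  define w where "w i = u i + (if i = 0 then c else 0)" for i
  have all: "\<phi> n i = cobd a b w (of_int n) i" for n i
  proof -
    have "\<psi> n i = cobd a b (\<lambda>i. if i = 0 then c else 0) (of_int n) i"
    proof (cases "n = 0")
      case True then show ?thesis using p0 by (simp add: cobd_def)
    next
      case False
      then show ?thesis using far[of i n] a1[of n] b2[of n]
        unfolding cobd_def by (cases "i = 0"; cases "i = of_int n") (auto simp: algebra_simps)
    qed
    then show ?thesis unfolding \<psi>_def w_def cobd_add by (simp add: algebra_simps)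
  qed
  \<comment> \<open>Although each \<open>U f\<close> has finite support, \<open>u\<close> is patched
    from infinitely many of them, so finiteness has to be proved anew for \<open>w\<close>, now at
    all positions.\<close>
  have "finite {j. True \<and> w j \<noteq> 0}"
    by (rule finite_supp_if_cobd_finite_supp[OF ab fin[of 1] fin[of 2]]) (use all in auto)
  then show ?thesis using all unfolding supp_def by auto
qed

section \<open>The adjoint and diagonal actions in coordinates\<close>

section \<open>The tensor square as a module\<close>

text \<open>\<open>ad e y\<close> is \<open>[e, y]\<close> in coordinates: every basis element \<open>b\<close> occurs in \<open>[e, d]\<close> for at most
  one \<open>d\<close>, so the formula makes sense for \<open>y\<close> of infinite support.\<close>
fun ad :: "B \<Rightarrow> (B \<Rightarrow> complex) \<Rightarrow> B \<Rightarrow> complex" where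
  "ad (L p) y (L q) = of_real (p - (q - p)) * y (L (q - p))"
| "ad (L p) y (I q) = of_real (p - (q - p)) * y (I (q - p))"
| "ad (L p) y (G q) = of_real (p / 2 - (q - p)) * y (G (q - p))"
| "ad (L p) y (H q) = of_real (p / 2 - (q - p)) * y (H (q - p))"
| "ad (I p) y (I q) = of_real (p - (q - p)) * y (L (q - p))"
| "ad (I p) y (H q) = of_real (p - 2 * (q - p)) * y (G (q - p))"
| "ad (G p) y (G q) = of_real (p - (q - p) / 2) * y (L (q - p))"
| "ad (G p) y (I q) = 1 * y (G (q - p))"
| "ad (G p) y (H q) = of_real (2 * p - (q - p)) * y (I (q - p))"
| "ad (H p) y (H q) = of_real (p - (q - p) / 2) * y (L (q - p))"
| "ad _ _ _ = 0"

lemma sg_simps [simp]: "sg False = 1" "sg True = -1"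
  by (simp_all add: sg_def)

text \<open>Each coordinate of \<open>ad e y\<close> reads at most one coordinate of
  \<open>y\<close>. Linearity, commutation of actions on different factors and sign rules follow
  from this form without going through pairs of basis types.\<close>

lemma ad_monomial: "\<exists>c d. (\<forall>y. ad e y b = c * y d) \<and> (c \<noteq> 0 \<longrightarrow> par d = (par b \<noteq> par e))"
proof -
  have *: ?thesis if "\<And>y. ad e y b = c * y d" "par d = (par b \<noteq> par e)" for c d
    using that by blast
  have 0: ?thesis if "\<And>y. ad e y b = 0"
    using that by (intro exI[of _ 0]) simp
  show ?thesis
    by (cases e; cases b) ((rule 0, simp; fail) | (rule *, simp only: ad.simps, simp))+
qed

lemma ad_add: "ad e (\<lambda>x. y x + z x) b = ad e y b + ad e z b"
  using ad_monomial[of e b] by (auto simp: distrib_left)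

lemma ad_scale: "ad e (\<lambda>x. c * y x) b = c * ad e y b"
  using ad_monomial[of e b] by auto

lemma ad_sum: "ad e (\<lambda>x. \<Sum>t\<in>T. f t x) b = (\<Sum>t\<in>T. ad e (f t) b)"
proof -
  obtain c d where "\<And>y. ad e y b = c * y d" using ad_monomial[of e b] by blast
  then show ?thesis by (simp add: sum_distrib_left)
qed

text \<open>A Koszul sign depends on the parity of a component before \<open>e\<close> acts on it;
  moving the sign outside expresses it by the parity afterwards.\<close>

lemma ad_sg: "ad e (\<lambda>x. sg (q \<and> par x) * y x) b = sg (q \<and> (par b \<noteq> par e)) * ad e y b"
proof -
  obtain c d where "\<And>y. ad e y b = c * y d" "c \<noteq> 0 \<longrightarrow> par d = (par b \<noteq> par e)"
    using ad_monomial[of e b] by blast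
  then show ?thesis by (cases "c = 0") auto
qed

lemma ad_commute: "ad e (\<lambda>x. ad f (\<lambda>z. v (x, z)) b') b = ad f (\<lambda>z. ad e (\<lambda>x. v (x, z)) b) b'"
proof -
  obtain c d c' d' where "\<And>y. ad e y b = c * y d" "\<And>y. ad f y b' = c' * y d'"
    using ad_monomial[of e b] ad_monomial[of f b'] by blast
  then show ?thesis by simp
qed

lemma br_eq_ad: "br e d b = ad e (vec d 1) b"
  by (cases e; cases d; cases b) (auto simp: vec_def)

lemma supp_vec_subset: "supp (vec b c) \<subseteq> {b}"
  by (auto simp: supp_def vec_def)

lemma br_vec: "\<exists>c g. br e f = vec g c"
proof -
  have "(\<lambda>_. 0) = vec e 0" by (auto simp: vec_def)
  then show ?thesis by (cases e; cases f) (simp_all, blast+)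
qed

lemma finite_supp_br: "finite (supp (br e f))"
  using br_vec[of e f] supp_vec_subset by (metis finite.emptyI finite.insertI finite_subset)

lemma sum_supp_vec: "(\<Sum>x\<in>supp (vec g c). vec g c x * F x) = c * F g"
proof -
  have "(\<Sum>x\<in>supp (vec g c). vec g c x * F x) = (\<Sum>x\<in>{g}. vec g c x * F x)"
    by (rule sum.mono_neutral_left) (use supp_vec_subset in \<open>auto simp: supp_def\<close>)
  then show ?thesis by (simp add: vec_def)
qed

lemma br_par: "br e f g \<noteq> 0 \<Longrightarrow> par g = (par e \<noteq> par f)"
  by (cases e; cases f) (auto simp: vec_def split: if_splits)

text \<open>The super Jacobi identity of the algebra in operator form; the sum on the right has at
  most one term.\<close>

lemma ad_br: "ad e (ad f y) b - sg (par e \<and> par f) * ad f (ad e y) b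
    = (\<Sum>g\<in>supp (br e f). br e f g * ad g y b)"
proof -
  have [simp]: "supp (\<lambda>_. 0) = {}" by (simp add: supp_def)
  have [simp]: "q - p - r = q - (p + r)" for p q r :: real by simp
  show ?thesis
    by (cases e; cases f; cases b)
       (simp_all add: sum_supp_vec, simp_all add: add.commute field_simps)
qed

text \<open>The diagonal action of one basis element, written so that it also makes sense for
  infinite support. In the second summand the first component is untouched, so its parity can be
  read off from \<open>k\<close>.\<close>

definition Act :: "B \<Rightarrow> (B \<times> B \<Rightarrow> complex) \<Rightarrow> B \<times> B \<Rightarrow> complex" where
  "Act e v k = ad e (\<lambda>x. v (x, snd k)) (fst k)
     + sg (par e \<and> par (fst k)) * ad e (\<lambda>x. v (fst k, x)) (snd k)"

lemma Act_add: "Act e (\<lambda>k. v k + w k) k = Act e v k + Act e w k"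
  by (simp add: Act_def ad_add distrib_left)

lemma Act_scale: "Act e (\<lambda>k. c * v k) k = c * Act e v k"
  by (simp add: Act_def ad_scale distrib_left)

lemma Act_diff: "Act e (\<lambda>k. v k - w k) k = Act e v k - Act e w k"
  using Act_add[of e v "\<lambda>k. -1 * w k" k] Act_scale[of e "-1" w k] by simp

lemma Act_sum: "Act e (\<lambda>k. \<Sum>t\<in>T. f t k) k = (\<Sum>t\<in>T. Act e (f t) k)"
  by (simp add: Act_def ad_sum sum.distrib sum_distrib_left)

lemma actb_eq_Act: "actb e t k = Act e (\<lambda>x. if x = t then 1 else 0) k"
proof -
  have "(\<lambda>x. if (x, snd k) = t then 1 else 0) = (\<lambda>x. (if snd k = snd t then 1 else 0) * vec (fst t) 1 x)"
    "(\<lambda>x. if (fst k, x) = t then 1 else 0) = (\<lambda>x. (if fst k = fst t then 1 else 0) * vec (snd t) 1 x)"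
    by (rule ext, cases t, simp add: vec_def)+
  then show ?thesis
    unfolding Act_def actb_def tens_def br_eq_ad by (simp only: ad_scale) (auto simp: vec_def)
qed

section \<open>Extending the action to finitely supported vectors\<close>

lemma sum_supp_superset:
  assumes "finite T" "supp x \<subseteq> T"
  shows "(\<Sum>e\<in>supp x. x e * F e) = (\<Sum>e\<in>T. x e * (F e :: complex))"
  using assms by (intro sum.mono_neutral_left) (auto simp: supp_def)

lemma act_eq_sum_Act:
  assumes "finite (supp v)"
  shows "act x v k = (\<Sum>e\<in>supp x. x e * Act e v k)"
proof -
  have v: "v = (\<lambda>k. \<Sum>t\<in>supp v. v t * (if k = t then 1 else 0))"
  proof
    fix k show "v k = (\<Sum>t\<in>supp v. v t * (if k = t then 1 else 0))"
      using assms by (simp add: if_distrib[of "(*) _"] cong: if_cong) (simp add: supp_def)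
  qed
  have "Act e v k = (\<Sum>t\<in>supp v. v t * actb e t k)" for e
  proof -
    have "Act e v k = Act e (\<lambda>k. \<Sum>t\<in>supp v. v t * (if k = t then 1 else 0)) k"
      using v by simp
    then show ?thesis by (simp only: Act_sum Act_scale actb_eq_Act)
  qed
  then show ?thesis unfolding act_def by (simp add: sum_distrib_left mult.assoc)
qed

lemma act_vec: "finite (supp v) \<Longrightarrow> act (vec e c) v k = c * Act e v k"
  by (simp add: act_eq_sum_Act sum_supp_vec)

text \<open>The terms in which \<open>e\<close> and \<open>f\<close> act on different factors cancel
  by the Koszul signs; the terms acting on one factor are covered by \<open>ad_br\<close>.\<close>

lemma Act_br: "Act e (Act f v) k - sg (par e \<and> par f) * Act f (Act e v) k
    = (\<Sum>g\<in>supp (br e f). br e f g * Act g v k)"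
proof -
  obtain b1 b2 where k: "k = (b1, b2)" by (cases k)
  have *: "Act e (Act f v) (b1, b2) = ad e (ad f (\<lambda>x. v (x, b2))) b1
      + sg (par f \<and> (par b1 \<noteq> par e)) * ad f (\<lambda>z. ad e (\<lambda>x. v (x, z)) b1) b2
      + sg (par e \<and> par b1) * ad e (\<lambda>z. ad f (\<lambda>x. v (x, z)) b1) b2
      + sg (par e \<and> par b1) * sg (par f \<and> par b1) * ad e (ad f (\<lambda>x. v (b1, x))) b2" for e f
    unfolding Act_def by (simp add: ad_add ad_scale ad_sg ad_commute distrib_left mult.assoc)
  have "(\<Sum>g\<in>supp (br e f). br e f g * Act g v (b1, b2))
    = (\<Sum>g\<in>supp (br e f). br e f g * ad g (\<lambda>x. v (x, b2)) b1
        + sg ((par e \<noteq> par f) \<and> par b1) * (br e f g * ad g (\<lambda>x. v (b1, x)) b2))"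
  proof (intro sum.cong refl)
    fix g assume "g \<in> supp (br e f)"
    then have "par g = (par e \<noteq> par f)" by (auto simp: supp_def dest: br_par)
    then show "br e f g * Act g v (b1, b2) = br e f g * ad g (\<lambda>x. v (x, b2)) b1
        + sg ((par e \<noteq> par f) \<and> par b1) * (br e f g * ad g (\<lambda>x. v (b1, x)) b2)"
      by (simp add: Act_def distrib_left)
  qed
  also have "\<dots> = ad e (ad f (\<lambda>x. v (x, b2))) b1 - sg (par e \<and> par f) * ad f (ad e (\<lambda>x. v (x, b2))) b1
      + sg ((par e \<noteq> par f) \<and> par b1) * (ad e (ad f (\<lambda>x. v (b1, x))) b2
        - sg (par e \<and> par f) * ad f (ad e (\<lambda>x. v (b1, x))) b2)"
    by (simp only: sum.distrib ad_br sum_distrib_left[symmetric])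
  finally show ?thesis unfolding k * by (cases "par e"; cases "par f"; cases "par b1") simp_all
qed

lemma act_nonzero:
  assumes "act x v k \<noteq> 0"
  shows "\<exists>e\<in>supp x. \<exists>t\<in>supp v. br e (fst t) (fst k) \<noteq> 0 \<and> snd k = snd t
     \<or> fst k = fst t \<and> br e (snd t) (snd k) \<noteq> 0"
proof -
  obtain e where e: "e \<in> supp x" "(\<Sum>t\<in>supp v. x e * v t * actb e t k) \<noteq> 0"
    using assms unfolding act_def by (meson sum.neutral)
  then obtain t where t: "t \<in> supp v" "actb e t k \<noteq> 0" by (metis (no_types, lifting) mult_eq_0_iff sum.neutral)
  then have "br e (fst t) (fst k) \<noteq> 0 \<and> snd k = snd t \<or> fst k = fst t \<and> br e (snd t) (snd k) \<noteq> 0"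
    unfolding actb_def tens_def vec_def by (auto split: if_splits)
  then show ?thesis using e t by blast
qed

lemma finite_supp_act:
  assumes "finite (supp x)" "finite (supp v)"
  shows "finite (supp (act x v))"
proof (rule finite_subset)
  show "supp (act x v) \<subseteq> (\<Union>e\<in>supp x. \<Union>t\<in>supp v. supp (br e (fst t)) \<times> {snd t} \<union> {fst t} \<times> supp (br e (snd t)))"
  proof
    fix k assume "k \<in> supp (act x v)"
    then have "act x v k \<noteq> 0" by (simp add: supp_def)
    from act_nonzero[OF this] show "k \<in> (\<Union>e\<in>supp x. \<Union>t\<in>supp v.
        supp (br e (fst t)) \<times> {snd t} \<union> {fst t} \<times> supp (br e (snd t)))"
      unfolding supp_def by (cases k) fastforce
  qed
qed (use assms finite_supp_br in blast)

lemma finite_supp_Act: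
  assumes "finite (supp v)" shows "finite (supp (Act e v))"
proof -
  have "Act e v = act (vec e 1) v" using act_vec[OF assms, of e 1] by auto
  then show ?thesis using finite_supp_act[OF _ assms, of "vec e 1"] finite_subset[OF supp_vec_subset, of e 1] by simp
qed

lemma act_act:
  assumes "finite (supp x)" "finite (supp y)" "finite (supp v)"
  shows "act x (act y v) k = (\<Sum>c\<in>supp x. \<Sum>d\<in>supp y. x c * y d * Act c (Act d v) k)"
proof -
  have "act y v = (\<lambda>k. \<Sum>d\<in>supp y. y d * Act d v k)" using act_eq_sum_Act[OF assms(3)] by auto
  then have "Act c (act y v) k = (\<Sum>d\<in>supp y. y d * Act c (Act d v) k)" for c
    by (simp only: Act_sum Act_scale)
  then show ?thesis
    using act_eq_sum_Act[OF finite_supp_act[OF assms(2,3)], of x k]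
    by (simp add: sum_distrib_left mult.assoc)
qed

lemma brk_nonzero: "brk x y g \<noteq> 0 \<Longrightarrow> \<exists>c\<in>supp x. \<exists>d\<in>supp y. br c d g \<noteq> 0"
  unfolding brk_def by (metis (no_types, lifting) mult_eq_0_iff sum.neutral)

lemma act_brk:
  assumes x: "finite (supp x)" "\<forall>b\<in>supp x. par b = qx"
    and y: "finite (supp y)" "\<forall>b\<in>supp y. par b = qy" and v: "finite (supp v)"
  shows "act (brk x y) v k = act x (act y v) k - sg (qx \<and> qy) * act y (act x v) k"
proof -
  \<comment> \<open>Cancellation can make the support of \<open>brk x y\<close> smaller than that of
    the individual brackets, so the sums are exchanged over this common finite superset.\<close>
  let ?T = "\<Union>c\<in>supp x. \<Union>d\<in>supp y. supp (br c d)"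
  have T: "finite ?T" using x y finite_supp_br by blast
  have sub: "supp (brk x y) \<subseteq> ?T" using brk_nonzero by (force simp: supp_def)
  have "act (brk x y) v k = (\<Sum>g\<in>?T. brk x y g * Act g v k)"
    using act_eq_sum_Act[OF v] sum_supp_superset[OF T sub] by simp
  also have "\<dots> = (\<Sum>g\<in>?T. \<Sum>c\<in>supp x. \<Sum>d\<in>supp y. x c * y d * (br c d g * Act g v k))"
    unfolding brk_def by (simp add: sum_distrib_right mult.assoc)
  also have "\<dots> = (\<Sum>c\<in>supp x. \<Sum>d\<in>supp y. \<Sum>g\<in>?T. x c * y d * (br c d g * Act g v k))"
    by (subst sum.swap, rule sum.cong[OF refl], rule sum.swap)
  also have "\<dots> = (\<Sum>c\<in>supp x. \<Sum>d\<in>supp y. x c * y d *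
      (Act c (Act d v) k - sg (qx \<and> qy) * Act d (Act c v) k))"
  proof (intro sum.cong refl)
    fix c d assume cd: "c \<in> supp x" "d \<in> supp y"
    have "(\<Sum>g\<in>?T. br c d g * Act g v k) = (\<Sum>g\<in>supp (br c d). br c d g * Act g v k)"
      by (rule sum_supp_superset[OF T, symmetric]) (use cd in blast)
    then show "(\<Sum>g\<in>?T. x c * y d * (br c d g * Act g v k)) = x c * y d *
      (Act c (Act d v) k - sg (qx \<and> qy) * Act d (Act c v) k)"
      using Act_br[of c d v k] x y cd by (simp add: sum_distrib_left[symmetric])
  qed
  also have "\<dots> = act x (act y v) k - sg (qx \<and> qy) * act y (act x v) k"
    unfolding act_act[OF x(1) y(1) v] act_act[OF y(1) x(1) v] sum.swap[of _ "supp y"]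
    by (simp add: right_diff_distrib sum_subtractf sum_distrib_left mult_ac)
  finally show ?thesis .
qed

section \<open>Weights, the Witt action and its invariants\<close>

section \<open>Derivations along the Witt subalgebra\<close>

fun wt :: "B \<Rightarrow> real" where
  "wt (L p) = p" | "wt (I p) = p" | "wt (G p) = p" | "wt (H p) = p"

text \<open>The parameter for which \<open>[L p, e]\<close> is \<open>al e * p - wt e\<close> times
  \<open>shift p e\<close>. In \<open>Act_L\<close> it appears as \<open>al b + 1\<close>, because
  the source there has weight \<open>wt b - p\<close>.\<close>

fun al :: "B \<Rightarrow> real" where
  "al (L p) = 1" | "al (I p) = 1" | "al (G p) = 1 / 2" | "al (H p) = 1 / 2"

fun shift :: "real \<Rightarrow> B \<Rightarrow> B" where
  "shift x (L p) = L (p + x)" | "shift x (I p) = I (p + x)"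
| "shift x (G p) = G (p + x)" | "shift x (H p) = H (p + x)"

lemma shift_shift [simp]: "shift x (shift y b) = shift (y + x) b"
  by (cases b) simp_all

lemma shift_0 [simp]: "shift 0 b = b"
  by (cases b) simp_all

lemma wt_shift [simp]: "wt (shift x b) = wt b + x"
  by (cases b) simp_all

lemma al_shift [simp]: "al (shift x b) = al b"
  by (cases b) simp_all

lemma par_shift [simp]: "par (shift x b) = par b"
  by (cases b) simp_all

lemma half_or_one_al: "half_or_one (al b)"
  by (cases b) simp_all

lemma al_mult_ge: "p \<ge> 0 \<Longrightarrow> al b * p \<ge> p / 2"
  by (cases b) simp_all

lemma Act_L: "Act (L p) v (b, c) = of_real ((al b + 1) * p - wt b) * v (shift (- p) b, c)
    + of_real ((al c + 1) * p - wt c) * v (b, shift (- p) c)"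
  unfolding Act_def by (cases b; cases c) (simp_all add: algebra_simps)

lemma br_L: "br (L p) e = vec (shift p e) (of_real (al e * p - wt e))"
  by (cases e) (simp_all add: add.commute)

lemma finite_supp_wt_bound:
  assumes "finite (supp (v :: B \<times> B \<Rightarrow> complex))"
  obtains C where "C \<ge> 0" "\<And>b c. v (b, c) \<noteq> 0 \<Longrightarrow> \<bar>wt b\<bar> \<le> C \<and> \<bar>wt c\<bar> \<le> C"
proof -
  let ?A = "insert 0 ((\<lambda>k. max \<bar>wt (fst k)\<bar> \<bar>wt (snd k)\<bar>) ` supp v)"
  have "max \<bar>wt b\<bar> \<bar>wt c\<bar> \<le> Max ?A" if "v (b, c) \<noteq> 0" for b c
    using that assms by (intro Max_ge) (force simp: supp_def)+
  moreover have "0 \<le> Max ?A" using assms by simp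
  ultimately show ?thesis using that[of "Max ?A"] by simp
qed

lemma of_int_mult_mem:
  fixes \<Gamma> :: "real set"
  assumes "0 \<in> \<Gamma>" "\<forall>x\<in>\<Gamma>. \<forall>y\<in>\<Gamma>. x + y \<in> \<Gamma>" "\<forall>x\<in>\<Gamma>. - x \<in> \<Gamma>" "x \<in> \<Gamma>"
  shows "of_int n * x \<in> \<Gamma>"
proof -
  have nat: "of_nat m * x \<in> \<Gamma>" for m
    by (induction m) (use assms in \<open>auto simp: distrib_right\<close>)
  show ?thesis
  proof (cases "n \<ge> 0")
    case True then show ?thesis using nat[of "nat n"] by simp
  next
    case False
    then have "of_int n * x = - (of_nat (nat (- n)) * x)" by simp
    moreover have "- (of_nat (nat (- n)) * x) \<in> \<Gamma>" using nat assms(3) by blast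
    ultimately show ?thesis by (simp only:)
  qed
qed

lemma valid_shift:
  assumes "\<forall>x\<in>\<Gamma>. \<forall>y\<in>\<Gamma>. x + y \<in> \<Gamma>" "p \<in> \<Gamma>" "valid \<Gamma> s b"
  shows "valid \<Gamma> s (shift p b)"
proof -
  have "x + p - s = (x - s) + p" for x by simp
  then show ?thesis using assms by (cases b) (auto simp: diff_add_eq)
qed

lemma ex_large_multiple:
  assumes "e > (0::real)" obtains n :: int where "C < of_int n * e"
  using ex_less_of_nat_mult[OF assms, of C] by (metis of_int_of_nat_eq)

text \<open>If \<open>C\<close> bounds the weights in the support and \<open>p > 2 * C\<close>, the
  coefficient of the image at \<open>(shift p b, c)\<close> can only come from
  \<open>(b, c)\<close>. Its factor \<open>al b * p - wt b\<close> is positive, as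
  \<open>al b\<close> is at least 1/2.\<close>

lemma no_invariants:
  assumes fin: "finite (supp v)" and e: "e > 0"
    and inv: "\<And>n k. Act (L (of_int n * e)) v k = 0"
  shows "v k = 0"
proof (rule ccontr)
  assume nz: "v k \<noteq> 0"
  obtain b c where k: "k = (b, c)" by (cases k)
  obtain C where C: "C \<ge> 0" "\<And>b c. v (b, c) \<noteq> 0 \<Longrightarrow> \<bar>wt b\<bar> \<le> C \<and> \<bar>wt c\<bar> \<le> C"
    using finite_supp_wt_bound[OF fin] by blast
  obtain n :: int where n: "2 * C < of_int n * e" using ex_large_multiple[OF e] by blast
  define p where "p = of_int n * e"
  have bc: "\<bar>wt b\<bar> \<le> C" using C(2) nz k by blast
  have z: "v (shift p b, d) = 0" for d
  proof (rule ccontr)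
    assume "v (shift p b, d) \<noteq> 0"
    then have "\<bar>wt (shift p b)\<bar> \<le> C" using C(2) by blast
    then show False using bc n unfolding p_def by simp
  qed
  have "Act (L p) v (shift p b, c) = 0" using inv unfolding p_def by blast
  then have "of_real (al b * p - wt b) * v (b, c) = 0"
    unfolding Act_L z by (simp add: algebra_simps)
  then have "al b * p = wt b" using nz k by (simp only: mult_eq_0_iff of_real_eq_0_iff) auto
  moreover have "al b * p > C" using al_mult_ge[of p b] n C(1) unfolding p_def by linarith
  ultimately show False using bc by simp
qed

section \<open>Families on the basis that obey the derivation rule along the Witt subalgebra\<close>

definition inn_fam :: "bool \<Rightarrow> (B \<times> B \<Rightarrow> complex) \<Rightarrow> B \<Rightarrow> B \<times> B \<Rightarrow> complex" where
  "inn_fam P a e k = sg (P \<and> par e) * Act e a k"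

text \<open>The derivation rule for the pairs \<open>[L p, e]\<close>, the only instances that the proof uses.\<close>
definition L_der :: "real set \<Rightarrow> real \<Rightarrow> bool \<Rightarrow> (B \<Rightarrow> B \<times> B \<Rightarrow> complex) \<Rightarrow> bool" where
  "L_der \<Gamma> s P D \<longleftrightarrow> (\<forall>e. valid \<Gamma> s e \<longrightarrow> finite (supp (D e))) \<and>
     (\<forall>p\<in>\<Gamma>. \<forall>e k. valid \<Gamma> s e \<longrightarrow> of_real (al e * p - wt e) * D (shift p e) k
        = Act (L p) (D e) k - sg (par e \<and> P) * Act e (D (L p)) k)"

lemma L_der_inn_fam:
  assumes "finite (supp a)" shows "L_der \<Gamma> s P (inn_fam P a)"
proof -
  have "finite (supp (inn_fam P a e))" for e
    by (rule finite_subset[OF _ finite_supp_Act[OF assms, of e]]) (auto simp: supp_def inn_fam_def)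
  moreover have "of_real (al e * p - wt e) * inn_fam P a (shift p e) k
        = Act (L p) (inn_fam P a e) k - sg (par e \<and> P) * Act e (inn_fam P a (L p)) k" for p e k
  proof -
    have "Act (L p) (Act e a) k - Act e (Act (L p) a) k = of_real (al e * p - wt e) * Act (shift p e) a k"
      using Act_br[of "L p" e a k] unfolding br_L sum_supp_vec by simp
    moreover have "inn_fam P a e = (\<lambda>k. sg (par e \<and> P) * Act e a k)" "inn_fam P a (L p) = Act (L p) a"
      by (auto simp: inn_fam_def conj_commute)
    ultimately show ?thesis
      by (simp only: Act_scale) (simp add: inn_fam_def conj_commute right_diff_distrib[symmetric])
  qed
  ultimately show ?thesis unfolding L_der_def by blast
qed

lemma L_der_diff:
  assumes "L_der \<Gamma> s P D" "L_der \<Gamma> s P D'"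
  shows "L_der \<Gamma> s P (\<lambda>e k. D e k - D' e k)"
proof -
  have "finite (supp (\<lambda>k. D e k - D' e k))" if "valid \<Gamma> s e" for e
    by (rule finite_subset[where B = "supp (D e) \<union> supp (D' e)"])
       (use assms that in \<open>auto simp: supp_def L_der_def\<close>)
  then show ?thesis using assms unfolding L_der_def Act_diff
    by (simp only: right_diff_distrib) (simp add: algebra_simps)
qed

lemma L_der_zero_of_zero_on_multiples:
  assumes \<Gamma>: "0 \<in> \<Gamma>" "\<forall>x\<in>\<Gamma>. \<forall>y\<in>\<Gamma>. x + y \<in> \<Gamma>" "\<forall>x\<in>\<Gamma>. - x \<in> \<Gamma>"
    and g: "g \<in> \<Gamma>" "g > 0" and D: "L_der \<Gamma> s P D"
    and zero: "\<And>n k. D (L (of_int n * g)) k = 0" and e: "valid \<Gamma> s e"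
  shows "D e k = 0"
proof (rule ccontr)
  assume nz: "D e k \<noteq> 0"
  obtain b c where k: "k = (b, c)" by (cases k)
  define v where "v = D e"
  have nz: "v (b, c) \<noteq> 0" using nz k v_def by simp
  have "finite (supp v)" using D e unfolding L_der_def v_def by blast
  then obtain C where C: "C \<ge> 0" "\<And>b c. v (b, c) \<noteq> 0 \<Longrightarrow> \<bar>wt b\<bar> \<le> C \<and> \<bar>wt c\<bar> \<le> C"
    using finite_supp_wt_bound by blast
  obtain n :: int where n: "2 * C + \<bar>wt e\<bar> < of_int n * g" using ex_large_multiple[OF g(2)] by blast
  define p where "p = of_int n * g"
  have p: "2 * C + \<bar>wt e\<bar> < p" using n p_def by simp
  have mem: "of_int m * g \<in> \<Gamma>" for m using of_int_mult_mem[OF \<Gamma> g(1)] .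
  have bc: "\<bar>wt b\<bar> \<le> C" "\<bar>wt c\<bar> \<le> C" using C(2) nz by blast+
  have z: "v (shift x b, d) = 0" if "\<bar>x\<bar> \<ge> p" for d x
  proof (rule ccontr)
    assume "v (shift x b, d) \<noteq> 0"
    then have "\<bar>wt (shift x b)\<bar> \<le> C" using C(2) by blast
    then show False using bc p that by simp
  qed
  have ve: "valid \<Gamma> s (shift (of_int m * g) e)" for m using valid_shift[OF \<Gamma>(2) mem e] .
  have rel: "of_real (al f * (of_int m * g) - wt f) * D (shift (of_int m * g) f) k
      = Act (L (of_int m * g)) (D f) k" if "valid \<Gamma> s f" for f m k
  proof -
    \<comment> \<open>Zero is written as a scalar multiple so that \<open>Act_scale\<close> shows
      its image to be zero.\<close>
    have "D (L (of_int m * g)) = (\<lambda>k. 0 * undefined k)" using zero by auto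
    then have "Act f (D (L (of_int m * g))) k = 0" by (simp only: Act_scale) simp
    moreover have "of_real (al f * (of_int m * g) - wt f) * D (shift (of_int m * g) f) k
      = Act (L (of_int m * g)) (D f) k - sg (par f \<and> P) * Act f (D (L (of_int m * g))) k"
      using D that mem[of m] unfolding L_der_def by blast
    ultimately show ?thesis by (simp only:) simp
  qed
  have 1: "of_real (al e * p - wt e) * D (shift p e) k = Act (L p) v k" for k
    using rel[OF e, of n] unfolding p_def v_def by simp
  have 2: "of_real (al e * (2 * p) - (wt e + p)) * D (shift (3 * p) e) k = Act (L (2 * p)) (D (shift p e)) k" for k
  proof -
    have "of_int (2 * n) * g = 2 * p" "p + 2 * p = 3 * p" "of_int n * g = p" unfolding p_def by simp_all
    then show ?thesis using rel[OF ve[of n], of "2 * n" k] by (simp only: shift_shift wt_shift al_shift)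
  qed
  have 3: "of_real (al e * (3 * p) - wt e) * D (shift (3 * p) e) k = Act (L (3 * p)) v k" for k
    using rel[OF e, of "3 * n" k] unfolding p_def v_def by (simp add: mult.assoc)
  \<comment> \<open>This coordinate is reached from \<open>(b, c)\<close> by letting
    \<open>L (2 * p)\<close> act on the first factor and \<open>L p\<close> on the second. A single
    \<open>L (3 * p)\<close> cannot reach it, since it leaves one factor unchanged.\<close>
  let ?k = "(shift (2 * p) b, shift p c)"
  have "of_real (al e * (3 * p) - wt e) * Act (L (2 * p)) (Act (L p) v) ?k
     = of_real (al e * p - wt e) * of_real (al e * (2 * p) - (wt e + p)) * Act (L (3 * p)) v ?k"
  proof -
    have "Act (L p) v = (\<lambda>k. of_real (al e * p - wt e) * D (shift p e) k)" using 1 by auto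
    then have "Act (L (2 * p)) (Act (L p) v) ?k = of_real (al e * p - wt e) * Act (L (2 * p)) (D (shift p e)) ?k"
      by (simp only: Act_scale)
    then show ?thesis unfolding 2[symmetric] 3[symmetric] by (simp only: mult_ac)
  qed
  moreover have "Act (L (3 * p)) v ?k = 0"
    unfolding Act_L using z p C(1) by simp
  moreover have "Act (L (2 * p)) (Act (L p) v) ?k
      = of_real (al b * (2 * p) - wt b) * (of_real (al c * p - wt c) * v (b, c))"
    unfolding Act_L using z p C(1) by (simp add: Act_L algebra_simps)
  ultimately have "of_real (al e * (3 * p) - wt e) * (of_real (al b * (2 * p) - wt b) *
      (of_real (al c * p - wt c) * v (b, c))) = 0" by simp
  then have "al e * (3 * p) - wt e = 0 \<or> al b * (2 * p) - wt b = 0 \<or> al c * p - wt c = 0"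
    using nz by (simp only: mult_eq_0_iff of_real_eq_0_iff) blast
  moreover have "al e * (3 * p) \<ge> 3 / 2 * p" "al b * (2 * p) \<ge> p" "al c * p \<ge> p / 2"
    using al_mult_ge[of "3 * p" e] al_mult_ge[of "2 * p" b] al_mult_ge[of p c] p C(1) by auto
  ultimately show False using p bc C(1) by argo
qed

text \<open>\<open>L 0\<close> acts on weight m as the scalar -m, so an inner family can absorb
  every part of \<open>D (L 0)\<close> of nonzero weight. The rule for \<open>[L 0, L q]\<close>
  then makes the weight-zero rest invariant under all \<open>L q\<close>, hence zero, and forces the
  corrected image of \<open>L q\<close> into weight \<open>q\<close>.\<close>

lemma L_der_normalize_weights:
  assumes \<Gamma>: "0 \<in> \<Gamma>" "\<forall>x\<in>\<Gamma>. \<forall>y\<in>\<Gamma>. x + y \<in> \<Gamma>" "\<forall>x\<in>\<Gamma>. - x \<in> \<Gamma>"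
    and g: "g \<in> \<Gamma>" "g > 0" and D: "L_der \<Gamma> s P D"
  obtains a where "finite (supp a)" "\<And>k. D (L 0) k = inn_fam P a (L 0) k"
    "\<And>q b c. q \<in> \<Gamma> \<Longrightarrow> wt b + wt c \<noteq> q \<Longrightarrow> D (L q) (b, c) = inn_fam P a (L q) (b, c)"
proof -
  define v where "v = D (L 0)"
  have fv: "finite (supp v)" using D \<Gamma>(1) unfolding L_der_def v_def by simp
  \<comment> \<open>In weight zero the quotient is 0 by the convention for division by 0, so
    \<open>a\<close> has no component there.\<close>
  define a where "a k = - v k / of_real (wt (fst k) + wt (snd k))" for k
  have fa: "finite (supp a)" by (rule finite_subset[OF _ fv]) (auto simp: supp_def a_def)
  define E where "E e k = D e k - inn_fam P a e k" for e k
  have E: "L_der \<Gamma> s P E" unfolding E_def by (rule L_der_diff[OF D L_der_inn_fam[OF fa]])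
  have A0: "Act (L 0) w (b, c) = - of_real (wt b + wt c) * w (b, c)" for w b c
    unfolding Act_L by (simp add: algebra_simps)
  have E0: "E (L 0) (b, c) = 0" if "wt b + wt c \<noteq> 0" for b c
  proof -
    have "of_real (wt b + wt c) \<noteq> (0::complex)" using that of_real_eq_0_iff by blast
    then show ?thesis unfolding E_def inn_fam_def A0 v_def[symmetric] a_def by (simp del: of_real_add)
  qed
  have main: "of_real (wt b + wt c - q) * E (L q) (b, c) = - Act (L q) (E (L 0)) (b, c)"
    if "q \<in> \<Gamma>" for q b c
  proof -
    have "valid \<Gamma> s (L q)" using that by simp
    then have "of_real (al (L q) * 0 - wt (L q)) * E (shift 0 (L q)) (b, c)
        = Act (L 0) (E (L q)) (b, c) - sg (par (L q) \<and> P) * Act (L q) (E (L 0)) (b, c)"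
      using E \<Gamma>(1) unfolding L_der_def by blast
    then show ?thesis unfolding A0 by (simp add: algebra_simps)
  qed
  have inv: "Act (L q) (E (L 0)) (b, c) = 0" if q: "q \<in> \<Gamma>" for q b c
  proof (cases "wt b + wt c = q")
    case True then show ?thesis using main[OF q, of b c] by simp
  next
    case False
    then show ?thesis unfolding Act_L by (simp add: E0)
  qed
  have "finite (supp (E (L 0)))" using E \<Gamma>(1) unfolding L_der_def by simp
  then have "E (L 0) k = 0" for k
    using no_invariants[OF _ g(2)] inv of_int_mult_mem[OF \<Gamma> g(1)] by (metis surj_pair)
  moreover have "E (L q) (b, c) = 0" if "q \<in> \<Gamma>" "wt b + wt c \<noteq> q" for q b c
  proof -
    have "of_real (wt b + wt c - q) * E (L q) (b, c) = 0" using main inv that by simp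
    then show ?thesis using that(2) by (simp only: mult_eq_0_iff of_real_eq_0_iff) simp
  qed
  ultimately show ?thesis using that[OF fa] unfolding E_def by simp
qed

text \<open>Measuring in units of \<open>g\<close> turns the restriction to multiples of
  \<open>g\<close> into a cocycle with integer steps. The weight-zero vectors \<open>t\<close> and
  \<open>t'\<close> serve only to fix the types of the two factors.\<close>

lemma L_der_weight_component:
  assumes \<Gamma>: "0 \<in> \<Gamma>" "\<forall>x\<in>\<Gamma>. \<forall>y\<in>\<Gamma>. x + y \<in> \<Gamma>" "\<forall>x\<in>\<Gamma>. - x \<in> \<Gamma>"
    and g: "g \<in> \<Gamma>" "g > 0" and D: "L_der \<Gamma> s P D" and D0: "\<And>k. D (L 0) k = 0"
    and tu: "wt t = 0" "wt t' = 0"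
  shows "\<exists>u. finite (supp u) \<and> (\<forall>n i. D (L (of_int n * g)) (shift (of_int n * g - i) t, shift i t')
      = cobd (al t) (al t') u (of_int n * g) i)"
proof -
  have mem: "of_int m * g \<in> \<Gamma>" for m using of_int_mult_mem[OF \<Gamma> g(1)] .
  have g0: "complex_of_real g \<noteq> 0" using g(2) by simp
  define \<phi> where "\<phi> n i = D (L (of_int n * g)) (shift ((of_int n - i) * g) t, shift (i * g) t')"
    for n :: int and i :: real
  have "cocycle (al t) (al t') \<phi>" unfolding cocycle_def
  proof (intro allI)
    fix p q :: int and i :: real
    have "valid \<Gamma> s (L (of_int q * g))" using mem by simp
    then have "of_real (al (L (of_int q * g)) * (of_int p * g) - wt (L (of_int q * g))) * D (shift (of_int p * g) (L (of_int q * g))) k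
        = Act (L (of_int p * g)) (D (L (of_int q * g))) k - sg (par (L (of_int q * g)) \<and> P) * Act (L (of_int q * g)) (D (L (of_int p * g))) k" for k
      using D mem[of p] unfolding L_der_def by blast
    then have "of_real g * (of_int (p - q) * D (L (of_int (p + q) * g)) k)
      = Act (L (of_int p * g)) (D (L (of_int q * g))) k - Act (L (of_int q * g)) (D (L (of_int p * g))) k" for k
      by (simp add: algebra_simps)
    then have "of_real g * (of_int (p - q) * \<phi> (p + q) i) =
        Act (L (of_int p * g)) (D (L (of_int q * g))) (shift ((of_int (p + q) - i) * g) t, shift (i * g) t')
      - Act (L (of_int q * g)) (D (L (of_int p * g))) (shift ((of_int (p + q) - i) * g) t, shift (i * g) t')"
      unfolding \<phi>_def by simp
    moreover have "Act (L (of_int p * g)) (D (L (of_int q * g))) (shift ((of_int (p + q) - i) * g) t, shift (i * g) t')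
      = of_real g * (of_real (al t * of_int p - of_int q + i) * \<phi> q i
       + of_real ((al t' + 1) * of_int p - i) * \<phi> q (i - of_int p))" for p q
    proof -
      have e: "shift (- (of_int p * g)) (shift ((of_int (p + q) - i) * g) t) = shift ((of_int q - i) * g) t"
        "shift (- (of_int p * g)) (shift (i * g) t') = shift ((i - of_int p) * g) t'"
        by (simp_all add: algebra_simps)
      have c: "(al (shift ((of_int (p + q) - i) * g) t) + 1) * (of_int p * g) - wt (shift ((of_int (p + q) - i) * g) t)
          = g * (al t * of_int p - of_int q + i)"
        "(al (shift (i * g) t') + 1) * (of_int p * g) - wt (shift (i * g) t') = g * ((al t' + 1) * of_int p - i)"
        by (simp_all add: tu algebra_simps)
      have d: "(of_int q - (i - of_int p)) * g = (of_int (p + q) - i) * g" by (simp add: algebra_simps)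
      show ?thesis unfolding Act_L e c \<phi>_def d by (simp only: of_real_mult mult.assoc) (simp only: distrib_left)
    qed
    note this[of p q] this[of q p]
    ultimately have "of_real g * (of_int (p - q) * \<phi> (p + q) i) =
       of_real g * (of_real (al t * of_int p - of_int q + i) * \<phi> q i
       + of_real ((al t' + 1) * of_int p - i) * \<phi> q (i - of_int p)
       - of_real (al t * of_int q - of_int p + i) * \<phi> p i
       - of_real ((al t' + 1) * of_int q - i) * \<phi> p (i - of_int q))"
      by (simp only: add.commute[of q p] right_diff_distrib distrib_left) (simp add: algebra_simps)
    then show "of_int (p - q) * \<phi> (p + q) i =
       of_real (al t * of_int p - of_int q + i) * \<phi> q i
       + of_real ((al t' + 1) * of_int p - i) * \<phi> q (i - of_int p)
       - of_real (al t * of_int q - of_int p + i) * \<phi> p i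
       - of_real ((al t' + 1) * of_int q - i) * \<phi> p (i - of_int q)"
      using g0 by (simp only: mult_cancel_left) simp
  qed
  moreover have "finite (supp (\<phi> n))" for n
  proof (rule finite_subset)
    show "supp (\<phi> n) \<subseteq> (\<lambda>k. wt (snd k) / g) ` supp (D (L (of_int n * g)))"
    proof
      fix i assume "i \<in> supp (\<phi> n)"
      then have "(shift ((of_int n - i) * g) t, shift (i * g) t') \<in> supp (D (L (of_int n * g)))"
        unfolding supp_def \<phi>_def by simp
      moreover have "i = wt (snd (shift ((of_int n - i) * g) t, shift (i * g) t')) / g"
        using g(2) tu by simp
      ultimately show "i \<in> (\<lambda>k. wt (snd k) / g) ` supp (D (L (of_int n * g)))" by blast
    qed
    show "finite ((\<lambda>k. wt (snd k) / g) ` supp (D (L (of_int n * g))))"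
      using D mem[of n] unfolding L_der_def by simp
  qed
  moreover have "\<phi> 0 i = 0" for i unfolding \<phi>_def using D0 by simp
  ultimately obtain u where u: "finite (supp u)" "\<And>n i. \<phi> n i = cobd (al t) (al t') u (of_int n) i"
    using cocycle_is_cobd[OF half_or_one_al half_or_one_al] by meson
  \<comment> \<open>Going back from units of \<open>g\<close> multiplies the coefficients of
    \<open>cobd\<close> by \<open>g\<close>; the division undoes this.\<close>
  define w where "w i = u (i / g) / of_real g" for i
  have "supp w \<subseteq> (\<lambda>i. i * g) ` supp u"
  proof
    fix i assume "i \<in> supp w"
    then have "i / g \<in> supp u" unfolding supp_def w_def by auto
    moreover have "i = (i / g) * g" using g by simp
    ultimately show "i \<in> (\<lambda>i. i * g) ` supp u" by blast
  qed
  then have "finite (supp w)" using u(1) finite_surj by blast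
  moreover have "D (L (of_int n * g)) (shift (of_int n * g - i) t, shift i t') = cobd (al t) (al t') w (of_int n * g) i" for n i
  proof -
    have "(of_int n - i / g) * g = of_int n * g - i" "i / g * g = i" using g by (simp_all add: field_simps)
    then have "D (L (of_int n * g)) (shift (of_int n * g - i) t, shift i t') = \<phi> n (i / g)"
      unfolding \<phi>_def by simp
    also have "\<dots> = cobd (al t) (al t') u (of_int n) (i / g)" by (rule u(2))
    also have "\<dots> = cobd (al t) (al t') w (of_int n * g) i"
    proof -
      have e: "i / g - of_int n = (i - of_int n * g) / g" using g by (simp add: field_simps)
      have c: "al t * of_int n + i / g = (al t * (of_int n * g) + i) / g"
        "(al t' + 1) * of_int n - i / g = ((al t' + 1) * (of_int n * g) - i) / g"
        using g by (simp_all add: field_simps)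
      show ?thesis unfolding cobd_def w_def e c by (simp only: of_real_divide) simp
    qed
    finally show ?thesis .
  qed
  ultimately show ?thesis by blast
qed

theorem L_der_inner:
  assumes \<Gamma>: "0 \<in> \<Gamma>" "\<forall>x\<in>\<Gamma>. \<forall>y\<in>\<Gamma>. x + y \<in> \<Gamma>" "\<forall>x\<in>\<Gamma>. - x \<in> \<Gamma>" "\<Gamma> \<noteq> {0}"
    and D: "L_der \<Gamma> s P D"
  shows "\<exists>a. finite (supp a) \<and> (\<forall>e. valid \<Gamma> s e \<longrightarrow> D e = inn_fam P a e)"
proof -
  obtain g where g: "g \<in> \<Gamma>" "g > 0"
  proof -
    obtain x where "x \<in> \<Gamma>" "x \<noteq> 0" using \<Gamma> by blast
    then show ?thesis using that[of x] that[of "- x"] \<Gamma>(3) by (cases "x > 0") auto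
  qed
  have mem: "of_int m * g \<in> \<Gamma>" for m using of_int_mult_mem[OF \<Gamma>(1-3) g(1)] .
  obtain a where a: "finite (supp a)" "\<And>k. D (L 0) k = inn_fam P a (L 0) k"
    "\<And>q b c. q \<in> \<Gamma> \<Longrightarrow> wt b + wt c \<noteq> q \<Longrightarrow> D (L q) (b, c) = inn_fam P a (L q) (b, c)"
    using L_der_normalize_weights[OF \<Gamma>(1-3) g D] by blast
  define E where "E e k = D e k - inn_fam P a e k" for e k
  have E: "L_der \<Gamma> s P E" unfolding E_def by (rule L_der_diff[OF D L_der_inn_fam[OF a(1)]])
  have E0: "E (L 0) k = 0" for k unfolding E_def using a(2) by simp
  have Ew: "E (L q) (b, c) = 0" if "q \<in> \<Gamma>" "wt b + wt c \<noteq> q" for q b c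
    unfolding E_def using a(3) that by simp
  define base where "base b = shift (- wt b) b" for b
  have base: "wt (base b) = 0" "shift (wt b) (base b) = b" "base (shift x b) = base b" "al (base b) = al b" for b x
    unfolding base_def by simp_all
  have "\<forall>t t'. \<exists>u. wt t = 0 \<and> wt t' = 0 \<longrightarrow> finite (supp u) \<and>
      (\<forall>n i. E (L (of_int n * g)) (shift (of_int n * g - i) t, shift i t') = cobd (al t) (al t') u (of_int n * g) i)"
    using L_der_weight_component[OF \<Gamma>(1-3) g E E0] by blast
  then obtain U where U: "\<And>t t'. wt t = 0 \<Longrightarrow> wt t' = 0 \<Longrightarrow> finite (supp (U t t'))"
    "\<And>t t' n i. wt t = 0 \<Longrightarrow> wt t' = 0 \<Longrightarrow> E (L (of_int n * g)) (shift (of_int n * g - i) t, shift i t')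
       = cobd (al t) (al t') (U t t') (of_int n * g) i" by metis
  \<comment> \<open>The solutions for the sixteen pairs of types are assembled into one tensor of
    weight zero; the weight of the second factor is the position \<open>i\<close>.\<close>
  define a' where "a' k = (if wt (fst k) + wt (snd k) = 0 then U (base (fst k)) (base (snd k)) (wt (snd k)) else 0)" for k
  have fa': "finite (supp a')"
  proof (rule finite_subset)
    let ?T = "{L 0, I 0, G 0, H 0}"
    show "supp a' \<subseteq> (\<Union>t\<in>?T. \<Union>t'\<in>?T. (\<lambda>i. (shift (- i) t, shift i t')) ` supp (U t t'))"
    proof
      fix k assume k: "k \<in> supp a'"
      have T: "base b \<in> ?T" for b unfolding base_def by (cases b) simp_all
      have w: "wt (fst k) = - wt (snd k)" "wt (snd k) \<in> supp (U (base (fst k)) (base (snd k)))"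
        using k unfolding supp_def a'_def by (auto split: if_splits)
      have "k = (shift (- wt (snd k)) (base (fst k)), shift (wt (snd k)) (base (snd k)))"
        using base(2)[of "fst k"] base(2)[of "snd k"] unfolding w(1) by simp
      then have "k \<in> (\<lambda>i. (shift (- i) (base (fst k)), shift i (base (snd k)))) ` supp (U (base (fst k)) (base (snd k)))"
        using w(2) by (rule image_eqI)
      then show "k \<in> (\<Union>t\<in>?T. \<Union>t'\<in>?T. (\<lambda>i. (shift (- i) t, shift i t')) ` supp (U t t'))"
        using T by blast
    qed
    show "finite (\<Union>t\<in>?T. \<Union>t'\<in>?T. (\<lambda>i. (shift (- i) t, shift i t')) ` supp (U t t'))"
      using U(1) by simp
  qed
  have EL: "E (L (of_int n * g)) (b, c) = Act (L (of_int n * g)) a' (b, c)" for n b c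
  proof (cases "wt b + wt c = of_int n * g")
    case True
    define q where "q = of_int n * g"
    have wb: "wt b = q - wt c" using True q_def by simp
    have "E (L q) (b, c) = E (L q) (shift (q - wt c) (base b), shift (wt c) (base c))"
      using base(2)[of b] base(2)[of c] unfolding wb by simp
    also have "\<dots> = cobd (al b) (al c) (U (base b) (base c)) q (wt c)"
      using U(2)[OF base(1) base(1), of n "wt c" b c] unfolding base(4) q_def by simp
    also have "\<dots> = Act (L q) a' (b, c)"
      unfolding Act_L cobd_def a'_def by (simp add: base(3) wb algebra_simps)
    finally show ?thesis unfolding q_def .
  next
    case False
    then show ?thesis unfolding Act_L a'_def using Ew[OF mem False] by simp
  qed
  define F where "F e k = E e k - inn_fam P a' e k" for e k
  have F: "L_der \<Gamma> s P F" unfolding F_def by (rule L_der_diff[OF E L_der_inn_fam[OF fa']])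
  have "F (L (of_int n * g)) k = 0" for n k
    unfolding F_def inn_fam_def using EL by (cases k) simp
  then have F0: "F e k = 0" if "valid \<Gamma> s e" for e k
    using L_der_zero_of_zero_on_multiples[OF \<Gamma>(1-3) g F _ that] by blast
  have "D e = inn_fam P (\<lambda>k. a k + a' k) e" if "valid \<Gamma> s e" for e
  proof
    fix k show "D e k = inn_fam P (\<lambda>k. a k + a' k) e k"
      using F0[OF that, of k] unfolding F_def E_def inn_fam_def Act_add by (simp add: algebra_simps)
  qed
  moreover have "finite (supp (\<lambda>k. a k + a' k))"
    by (rule finite_subset[OF _ finite_UnI[OF a(1) fa']]) (auto simp: supp_def)
  ultimately show ?thesis by blast
qed

section \<open>From families on the basis to derivations of the algebra, and back\<close>

section \<open>Derivations and inner derivations\<close>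

text \<open>The condition on \<open>2 * s\<close> enters through
  \<open>[G r, G t] = I (r + t)\<close>, whose index must lie in \<Gamma>.\<close>

lemma br_valid:
  assumes "\<forall>x\<in>\<Gamma>. \<forall>y\<in>\<Gamma>. x + y \<in> \<Gamma>" "2 * s \<in> \<Gamma>"
    and "valid \<Gamma> s e" "valid \<Gamma> s f" "br e f g \<noteq> 0"
  shows "valid \<Gamma> s g"
proof -
  have 1: "x + r - s \<in> \<Gamma>" if "x \<in> \<Gamma>" "r - s \<in> \<Gamma>" for x r
    using assms(1) that by (metis add_diff_eq)
  have 2: "r + t \<in> \<Gamma>" if "r - s \<in> \<Gamma>" "t - s \<in> \<Gamma>" for r t
  proof -
    have "r + t = (r - s) + (t - s) + 2 * s" by simp
    then show ?thesis using assms(1,2) that by metis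
  qed
  show ?thesis using assms(1,3-5) 1 2
    by (cases e; cases f) (auto simp: vec_def split: if_splits)
qed

lemma vec_Lcar: "valid \<Gamma> s e \<Longrightarrow> vec e c \<in> Lcar \<Gamma> s"
  unfolding Lcar_def using supp_vec_subset[of e c] finite_subset[of "supp (vec e c)" "{e}"] by auto

lemma homL_vec: "valid \<Gamma> s e \<Longrightarrow> homL \<Gamma> s (par e) (vec e c)"
  unfolding homL_def using vec_Lcar supp_vec_subset[of e c] by auto

lemma brk_vec: "brk (vec e 1) (vec f 1) = br e f"
proof
  fix b
  have "supp (vec e 1) = {e}" "supp (vec f 1) = {f}" by (auto simp: supp_def vec_def)
  then show "brk (vec e 1) (vec f 1) b = br e f b" unfolding brk_def by (simp add: vec_def)
qed

lemma is_der_expand: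
  assumes d: "is_der \<Gamma> s p d" and x: "x \<in> Lcar \<Gamma> s"
  shows "d x k = (\<Sum>e\<in>supp x. x e * d (vec e 1) k)"
proof -
  have scale: "d (\<lambda>b. c * x b) = (\<lambda>k. c * d x k)" if "x \<in> Lcar \<Gamma> s" for c x
    using d that unfolding is_der_def by blast
  have add: "d (\<lambda>b. x b + y b) = (\<lambda>k. d x k + d y k)" if "x \<in> Lcar \<Gamma> s" "y \<in> Lcar \<Gamma> s" for x y
    using d that unfolding is_der_def by blast
  \<comment> \<open>Induction on a finite set containing the support, with \<open>x\<close>
    arbitrary, so that one basis coefficient at a time can be split off.\<close>
  have "\<And>x. supp x \<subseteq> A \<Longrightarrow> d x k = (\<Sum>e\<in>A. x e * d (vec e 1) k)"
    if "finite A" "\<forall>b\<in>A. valid \<Gamma> s b" for A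
    using that
  proof (induction A rule: finite_induct)
    case empty
    then have x: "x = (\<lambda>b. 0 * x b)" "x \<in> Lcar \<Gamma> s" by (auto simp: supp_def Lcar_def)
    then have "d x = (\<lambda>k. 0 * d x k)" using scale[OF x(2), of 0] by simp
    then show ?case by (metis mult_zero_left sum.empty)
  next
    case (insert e A)
    define y where "y = x(e := 0)"
    have sy: "supp y \<subseteq> A" using insert.prems(1) unfolding y_def supp_def by auto
    have y: "y \<in> Lcar \<Gamma> s" unfolding Lcar_def
      using sy insert.hyps insert.prems by (auto intro: finite_subset)
    have e: "vec e 1 \<in> Lcar \<Gamma> s" "vec e (x e) \<in> Lcar \<Gamma> s" using vec_Lcar insert.prems by simp_all
    have "x = (\<lambda>b. y b + vec e (x e) b)" "vec e (x e) = (\<lambda>b. x e * vec e 1 b)"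
      unfolding y_def vec_def by auto
    then have "d x k = d y k + x e * d (vec e 1) k" using add[OF y e(2)] scale[OF e(1), of "x e"] by metis
    also have "d y k = (\<Sum>e\<in>A. y e * d (vec e 1) k)" using insert.IH[OF sy] insert.prems by simp
    also have "\<dots> = (\<Sum>e\<in>A. x e * d (vec e 1) k)"
      by (rule sum.cong) (use insert.hyps in \<open>auto simp: y_def\<close>)
    finally show ?case using insert.hyps by (simp add: add.commute)
  qed
  then show ?thesis using x unfolding Lcar_def by blast
qed

lemma inn_eq_sum:
  assumes a: "finite (supp a)" and T: "finite T" "supp x \<subseteq> T"
  shows "inn P a x k = (\<Sum>e\<in>T. x e * inn_fam P a e k)"
proof -
  have "supp (evp x) \<subseteq> T" "supp (odp x) \<subseteq> T" using T(2) unfolding supp_def evp_def odp_def by auto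
  then have "inn P a x k = (\<Sum>e\<in>T. evp x e * Act e a k) + sg P * (\<Sum>e\<in>T. odp x e * Act e a k)"
    unfolding inn_def act_eq_sum_Act[OF a] 
    using sum_supp_superset[OF T(1), where F = "\<lambda>e. Act e a k"] by simp
  also have "\<dots> = (\<Sum>e\<in>T. x e * inn_fam P a e k)"
    unfolding sum_distrib_left sum.distrib[symmetric]
    by (rule sum.cong) (auto simp: evp_def odp_def inn_fam_def)
  finally show ?thesis .
qed

lemma is_der_L_der:
  assumes \<Gamma>: "\<forall>x\<in>\<Gamma>. \<forall>y\<in>\<Gamma>. x + y \<in> \<Gamma>" and d: "is_der \<Gamma> s P d"
  shows "L_der \<Gamma> s P (\<lambda>e. d (vec e 1))"
proof -
  have fin: "finite (supp (d (vec e 1)))" if "valid \<Gamma> s e" for e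
    using d vec_Lcar[OF that] unfolding is_der_def Vcar_def by blast
  moreover have "of_real (al e * p - wt e) * d (vec (shift p e) 1) k
        = Act (L p) (d (vec e 1)) k - sg (par e \<and> P) * Act e (d (vec (L p) 1)) k"
    if p: "p \<in> \<Gamma>" and e: "valid \<Gamma> s e" for p e k
  proof -
    have Lp: "valid \<Gamma> s (L p)" using p by simp
    have v: "valid \<Gamma> s (shift p e)" using valid_shift[OF \<Gamma> p e] .
    have 1: "d (vec (shift p e) c) = d (\<lambda>b. c * vec (shift p e) 1 b)" for c
      by (rule arg_cong[of _ _ d]) (auto simp: vec_def)
    have 2: "d (\<lambda>b. c * vec (shift p e) 1 b) = (\<lambda>k. c * d (vec (shift p e) 1) k)" for c
      using d vec_Lcar[OF v, of 1] unfolding is_der_def by blast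
    have "c * d (vec (shift p e) 1) k = d (vec (shift p e) c) k" for c
      unfolding 1[of c] 2 ..
    then have "of_real (al e * p - wt e) * d (vec (shift p e) 1) k = d (br (L p) e) k"
      unfolding br_L .
    also have "\<dots> = sg (P \<and> par (L p)) * act (vec (L p) 1) (d (vec e 1)) k
        - sg (par e \<and> (P \<noteq> par (L p))) * act (vec e 1) (d (vec (L p) 1)) k"
    proof -
      have "d (brk (vec (L p) 1) (vec e 1)) = (\<lambda>k. sg (P \<and> par (L p)) * act (vec (L p) 1) (d (vec e 1)) k
        - sg (par e \<and> (P \<noteq> par (L p))) * act (vec e 1) (d (vec (L p) 1)) k)"
        using d homL_vec[OF Lp, of 1] homL_vec[OF e, of 1] unfolding is_der_def by blast
      then show ?thesis unfolding brk_vec by (rule fun_cong)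
    qed
    also have "\<dots> = Act (L p) (d (vec e 1)) k - sg (par e \<and> P) * Act e (d (vec (L p) 1)) k"
      by (simp add: act_vec fin Lp e del: valid.simps)
    finally show ?thesis .
  qed
  ultimately show ?thesis unfolding L_der_def by blast
qed

text \<open>\<open>L_der_inner\<close> yields an \<open>a\<close> of finite support that need not
  have valid indices or parity \<open>P\<close>. Its part \<open>w\<close> outside the required
  component is also invariant: each \<open>L p\<close> preserves that splitting and
  \<open>d (L p)\<close> lies inside the component. Hence \<open>w\<close> vanishes by
  \<open>no_invariants\<close>.\<close>

lemma is_der_inner:
  assumes \<Gamma>: "0 \<in> \<Gamma>" "\<forall>x\<in>\<Gamma>. \<forall>y\<in>\<Gamma>. x + y \<in> \<Gamma>" "\<forall>x\<in>\<Gamma>. - x \<in> \<Gamma>" "\<Gamma> \<noteq> {0}"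
    and d: "is_der \<Gamma> s P d"
  shows "\<exists>a. homV \<Gamma> s P a \<and> (\<forall>x\<in>Lcar \<Gamma> s. d x = inn P a x)"
proof -
  obtain a where a: "finite (supp a)" "\<And>e. valid \<Gamma> s e \<Longrightarrow> d (vec e 1) = inn_fam P a e"
    using L_der_inner[OF \<Gamma> is_der_L_der[OF \<Gamma>(2) d]] by blast
  define Q where "Q k \<longleftrightarrow> valid \<Gamma> s (fst k) \<and> valid \<Gamma> s (snd k) \<and> (par (fst k) \<noteq> par (snd k)) = P" for k
  define w where "w k = (if Q k then 0 else a k)" for k
  have valid_iff: "valid \<Gamma> s (shift (- p) b) \<longleftrightarrow> valid \<Gamma> s b" if "p \<in> \<Gamma>" for p b
    using valid_shift[OF \<Gamma>(2), of "- p" s b] valid_shift[OF \<Gamma>(2) that, of s "shift (- p) b"] that \<Gamma>(3)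
    by auto
  have "Act (L p) w k = 0" if p: "p \<in> \<Gamma>" for p k
  proof -
    obtain b c where k: "k = (b, c)" by (cases k)
    have Q: "Q (shift (- p) b, c) = Q (b, c)" "Q (b, shift (- p) c) = Q (b, c)"
      unfolding Q_def using valid_iff[OF p] by auto
    show ?thesis
    proof (cases "Q (b, c)")
      case True
      then show ?thesis unfolding k Act_L w_def Q by simp
    next
      case False
      have v: "valid \<Gamma> s (L p)" using p by simp
      have "homV \<Gamma> s (par (L p) \<noteq> P) (d (vec (L p) 1))"
        using d homL_vec[OF v, of 1] unfolding is_der_def by blast
      then have "d (vec (L p) 1) (b, c) = 0"
        using False unfolding homV_def Vcar_def supp_def Q_def by auto
      then have "Act (L p) a (b, c) = 0" using a(2)[OF v] by (simp add: inn_fam_def)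
      then show ?thesis using False unfolding k Act_L w_def Q by simp
    qed
  qed
  moreover obtain g where g: "g \<in> \<Gamma>" "g > 0"
  proof -
    obtain x where "x \<in> \<Gamma>" "x \<noteq> 0" using \<Gamma> by blast
    then show ?thesis using that[of x] that[of "- x"] \<Gamma>(3) by (cases "x > 0") auto
  qed
  moreover have "finite (supp w)" by (rule finite_subset[OF _ a(1)]) (auto simp: supp_def w_def)
  ultimately have "w k = 0" for k
    using no_invariants[of w g k] of_int_mult_mem[OF \<Gamma>(1-3) g(1)] by blast
  then have "Q k" if "a k \<noteq> 0" for k using that unfolding w_def by metis
  then have "homV \<Gamma> s P a" using a(1) unfolding homV_def Vcar_def Q_def supp_def by blast
  moreover have "d x = inn P a x" if x: "x \<in> Lcar \<Gamma> s" for x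
  proof
    fix k
    have "d x k = (\<Sum>e\<in>supp x. x e * inn_fam P a e k)"
      unfolding is_der_expand[OF d x] by (rule sum.cong) (use x a(2) in \<open>auto simp: Lcar_def\<close>)
    also have "\<dots> = inn P a x k"
      by (rule inn_eq_sum[OF a(1), symmetric]) (use x in \<open>auto simp: Lcar_def\<close>)
    finally show "d x k = inn P a x k" .
  qed
  ultimately show ?thesis by blast
qed

lemma inn_nonzero:
  assumes "inn P a x k \<noteq> 0"
  shows "\<exists>e\<in>supp x. \<exists>t\<in>supp a. br e (fst t) (fst k) \<noteq> 0 \<and> snd k = snd t
     \<or> fst k = fst t \<and> br e (snd t) (snd k) \<noteq> 0"
proof -
  have "supp (evp x) \<subseteq> supp x" "supp (odp x) \<subseteq> supp x" by (auto simp: supp_def evp_def odp_def)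
  moreover have "act (evp x) a k \<noteq> 0 \<or> act (odp x) a k \<noteq> 0" using assms unfolding inn_def by auto
  ultimately show ?thesis using act_nonzero[of "evp x" a k] act_nonzero[of "odp x" a k] by blast
qed

lemma inn_hom:
  assumes "\<forall>b\<in>supp x. par b = q"
  shows "inn P a x = (\<lambda>k. sg (P \<and> q) * act x a k)"
proof -
  have h: "x b = 0 \<or> par b = q" for b using assms by (auto simp: supp_def)
  have 0: "act (\<lambda>_. 0) a k = 0" for k by (simp add: act_def supp_def)
  show ?thesis
  proof (cases q)
    case True
    have "evp x = (\<lambda>_. 0)" "odp x = x"
      by (rule ext, use h True in \<open>force simp: evp_def odp_def\<close>)+
    then show ?thesis using True 0 by (simp add: inn_def)
  next
    case False
    have "evp x = x" "odp x = (\<lambda>_. 0)"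
      by (rule ext, use h False in \<open>force simp: evp_def odp_def\<close>)+
    then show ?thesis using False 0 by (simp add: inn_def)
  qed
qed

text \<open>On homogeneous arguments \<open>inn\<close> is a signed action, so the derivation rule
  is \<open>act_brk\<close> with a sign that agrees for all eight combinations of parities.\<close>

lemma is_der_inn:
  assumes \<Gamma>: "\<forall>x\<in>\<Gamma>. \<forall>y\<in>\<Gamma>. x + y \<in> \<Gamma>" "2 * s \<in> \<Gamma>" and a: "homV \<Gamma> s P a"
  shows "is_der \<Gamma> s P (inn P a)"
proof -
  have fa: "finite (supp a)" using a unfolding homV_def Vcar_def by blast
  have V: "inn P a x \<in> Vcar \<Gamma> s" if x: "x \<in> Lcar \<Gamma> s" for x
  proof -
    have fx: "finite (supp (evp x))" "finite (supp (odp x))"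
      by (rule finite_subset[of _ "supp x"], use x in \<open>auto simp: Lcar_def supp_def evp_def odp_def\<close>)+
    have "finite (supp (inn P a x))"
      by (rule finite_subset[OF _ finite_UnI[OF finite_supp_act[OF fx(1) fa] finite_supp_act[OF fx(2) fa]]])
         (auto simp: inn_def supp_def)
    moreover have "valid \<Gamma> s (fst k) \<and> valid \<Gamma> s (snd k)" if k: "k \<in> supp (inn P a x)" for k
    proof -
      have "inn P a x k \<noteq> 0" using k by (simp add: supp_def)
      from inn_nonzero[OF this] obtain e t where et: "e \<in> supp x" "t \<in> supp a"
        "br e (fst t) (fst k) \<noteq> 0 \<and> snd k = snd t \<or> fst k = fst t \<and> br e (snd t) (snd k) \<noteq> 0" by blast
      have "valid \<Gamma> s e" "valid \<Gamma> s (fst t)" "valid \<Gamma> s (snd t)"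
        using et x a unfolding Lcar_def homV_def Vcar_def by auto
      then show ?thesis using et(3) br_valid[OF \<Gamma>] by metis
    qed
    ultimately show ?thesis unfolding Vcar_def by blast
  qed
  moreover have "inn P a (\<lambda>b. x b + y b) = (\<lambda>k. inn P a x k + inn P a y k)"
    if "x \<in> Lcar \<Gamma> s" "y \<in> Lcar \<Gamma> s" for x y
  proof
    fix k
    have T: "finite (supp x \<union> supp y)" using that by (auto simp: Lcar_def)
    have "supp (\<lambda>b. x b + y b) \<subseteq> supp x \<union> supp y" by (auto simp: supp_def)
    then show "inn P a (\<lambda>b. x b + y b) k = inn P a x k + inn P a y k"
      by (simp add: inn_eq_sum[OF fa T] distrib_right sum.distrib)
  qed
  moreover have "inn P a (\<lambda>b. c * x b) = (\<lambda>k. c * inn P a x k)" if "x \<in> Lcar \<Gamma> s" for c x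
  proof
    fix k
    have T: "finite (supp x)" using that by (auto simp: Lcar_def)
    have "supp (\<lambda>b. c * x b) \<subseteq> supp x" by (auto simp: supp_def)
    then show "inn P a (\<lambda>b. c * x b) k = c * inn P a x k"
      by (simp add: inn_eq_sum[OF fa T] sum_distrib_left mult.assoc)
  qed
  moreover have "homV \<Gamma> s (q \<noteq> P) (inn P a x)" if x: "homL \<Gamma> s q x" for q x
  proof -
    have "(par (fst k) \<noteq> par (snd k)) = (q \<noteq> P)" if k: "k \<in> supp (inn P a x)" for k
    proof -
      have "inn P a x k \<noteq> 0" using k by (simp add: supp_def)
      from inn_nonzero[OF this] obtain e t where et: "e \<in> supp x" "t \<in> supp a"
        "br e (fst t) (fst k) \<noteq> 0 \<and> snd k = snd t \<or> fst k = fst t \<and> br e (snd t) (snd k) \<noteq> 0" by blast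
      have "par e = q" "(par (fst t) \<noteq> par (snd t)) = P"
        using et x a unfolding homL_def homV_def by auto
      then show ?thesis using et(3) br_par by metis
    qed
    then show ?thesis using V x unfolding homV_def homL_def by blast
  qed
  moreover have "inn P a (brk x y) = (\<lambda>k. sg (P \<and> qx) * act x (inn P a y) k
      - sg (qy \<and> (P \<noteq> qx)) * act y (inn P a x) k)"
    if x: "homL \<Gamma> s qx x" and y: "homL \<Gamma> s qy y" for qx qy x y
  proof
    fix k
    have fx: "finite (supp x)" "\<forall>b\<in>supp x. par b = qx" and fy: "finite (supp y)" "\<forall>b\<in>supp y. par b = qy"
      using x y unfolding homL_def Lcar_def by auto
    have "\<forall>b\<in>supp (brk x y). par b = (qx \<noteq> qy)"
    proof
      fix b assume "b \<in> supp (brk x y)"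
      then have "brk x y b \<noteq> 0" by (simp add: supp_def)
      from brk_nonzero[OF this] show "par b = (qx \<noteq> qy)" using br_par fx(2) fy(2) by metis
    qed
    note hxy = inn_hom[OF this, of P a]
    have sc: "act z (\<lambda>k. c * act z' a k) k = c * act z (act z' a) k" if "finite (supp z')" for z z' c
    proof -
      have f: "finite (supp (act z' a))" using finite_supp_act that fa by blast
      have "finite (supp (\<lambda>k. c * act z' a k))"
        by (rule finite_subset[OF _ f]) (auto simp: supp_def)
      then show ?thesis
        by (simp add: act_eq_sum_Act f Act_scale[of _ c] sum_distrib_left mult.left_commute)
    qed
    show "inn P a (brk x y) k = sg (P \<and> qx) * act x (inn P a y) k
      - sg (qy \<and> (P \<noteq> qx)) * act y (inn P a x) k"
      unfolding hxy inn_hom[OF fx(2), of P a] inn_hom[OF fy(2), of P a] sc[OF fx(1)] sc[OF fy(1)]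
        act_brk[OF fx fy fa]
      by (cases P; cases qx; cases qy) simp_all
  qed
  ultimately show ?thesis unfolding is_der_def by blast
qed

theorem mainTheorem1:
  fixes \<Gamma> :: "real set" and s :: real
  assumes "0 \<in> \<Gamma>"
    and "\<forall>x\<in>\<Gamma>. \<forall>y\<in>\<Gamma>. x + y \<in> \<Gamma>"
    and "\<forall>x\<in>\<Gamma>. - x \<in> \<Gamma>"
    and "\<Gamma> \<noteq> {0}"
    and "2 * s \<in> \<Gamma>"
  shows "\<forall>d. Der \<Gamma> s d \<longleftrightarrow> Inn \<Gamma> s d"
proof (intro allI iffI)
  fix d assume "Der \<Gamma> s d"
  then obtain d0 d1 where d: "is_der \<Gamma> s False d0" "is_der \<Gamma> s True d1"
    "\<forall>x\<in>Lcar \<Gamma> s. d x = (\<lambda>k. d0 x k + d1 x k)" unfolding Der_def by blast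
  obtain a0 a1 where "homV \<Gamma> s False a0" "\<forall>x\<in>Lcar \<Gamma> s. d0 x = inn False a0 x"
    "homV \<Gamma> s True a1" "\<forall>x\<in>Lcar \<Gamma> s. d1 x = inn True a1 x"
    using is_der_inner[OF assms(1-4) d(1)] is_der_inner[OF assms(1-4) d(2)] by blast
  then show "Inn \<Gamma> s d" unfolding Inn_def using d(3) by (intro exI[of _ a0] exI[of _ a1]) simp
next
  fix d assume "Inn \<Gamma> s d"
  then obtain a0 a1 where "homV \<Gamma> s False a0" "homV \<Gamma> s True a1"
    "\<forall>x\<in>Lcar \<Gamma> s. d x = (\<lambda>k. inn False a0 x k + inn True a1 x k)" unfolding Inn_def by blast
  then show "Der \<Gamma> s d" unfolding Der_def using is_der_inn[OF assms(2,5)] by blast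
qed

end
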